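(* Let $d\ge1$, $\lambda,\mu>0$, and let $g:\mathbb{R}^d\to[0,1]$ be a non-increasing radial function with $0<\int_{\mathbb{R}^d}g(x)\,dx<\infty$. Let $D$ be the degree of the origin vertex in the random intersection graph $\mathcal{G}_{\mathcal{V}}$, and let $f(y)=\int_{\mathbb{R}^d}g(x)g(y-x)\,dx$ for $y\in\mathbb{R}^d$. Then $$\mathbb{E}[D]=\lambda\int_{\mathbb{R}^d}\left(1-e^{-\mu f(y)}\right)dy.$$
   Context: A function $g:\mathbb{R}^d\to[0,1]$ is a non-increasing radial function if $g(x)=g(y)$ whenever $|x|=|y|$ and $g(x)\leq g(y)$ whenever $|x|\geq|y|$, where $|\cdot|$ is the Euclidean norm. Model. Let $\mathcal{V}$ (vertices) and $\mathcal{U}$ (groups) be the point sets of two independent homogeneous Poisson processes on $\mathbb{R}^d$ with intensities $\lambda$ and $\mu$, respectively, and add a point at the origin to $\mathcal{V}$ (Palm version). Given $\mathcal{V}$ and $\mathcal{U}$, each pair $(v,u)$ with $v\in\mathcal{V}$, $u\in\mathcal{U}$ is connected independently with probability $g(v-u)$; this gives a bipartite graph $\mathcal{G}_{\mathrm{bi}}$ with vertex set $\mathcal{V}\cup\mathcal{U}$. The random intersection graph $\mathcal{G}_{\mathcal{V}}$ has vertex set $\mathcal{V}$, and two distinct points $v_1,v_2\in\mathcal{V}$ are connected by an edge if and only if there exists $u\in\mathcal{U}$ such that both $v_1$ and $v_2$ are connected to $u$ in $\mathcal{G}_{\mathrm{bi}}$. The degree of the origin is the number of vertices $v\in\mathcal{V}\setminus\{0\}$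 that are connected to $0$ in $\mathcal{G}_{\mathcal{V}}$. *)

theory Defs
  imports "HOL-Probability.Probability"
begin

section \<open>Point configurations and Poisson processes\<close>

definition locally_finite :: "'a::metric_space set \<Rightarrow> bool" where
  "locally_finite S \<longleftrightarrow> (\<forall>B. bounded B \<longrightarrow> finite (S \<inter> B))"

definition config_space :: "'a::euclidean_space set measure" where
  "config_space = sigma {S. locally_finite S}
     {{S. locally_finite S \<and> card (S \<inter> B) = n} | B n. B \<in> sets borel \<and> bounded B}"

text \<open>
  The probabilities are written out, rather than stated with \<^term>\<open>poisson_pmf\<close>, because a
  set \<open>B\<close> of volume 0 gives the rate 0, for which \<^term>\<open>poisson_pmf\<close> is not specified.
\<close>

definition homogeneous_poisson_process ::
    "'w measure \<Rightarrow> real \<Rightarrow> ('w \<Rightarrow> 'a::euclidean_space set) \<Rightarrow> bool" where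
  "homogeneous_poisson_process M \<gamma> P \<longleftrightarrow>
     P \<in> M \<rightarrow>\<^sub>M config_space \<and>
     (\<forall>B n. B \<in> sets borel \<longrightarrow> bounded B \<longrightarrow>
        measure M {\<omega> \<in> space M. card (P \<omega> \<inter> B) = n} =
          (\<gamma> * measure lborel B) ^ n / fact n * exp (- (\<gamma> * measure lborel B))) \<and>
     (\<forall>B :: nat \<Rightarrow> 'a set. (\<forall>i. B i \<in> sets borel \<and> bounded (B i)) \<longrightarrow> disjoint_family B \<longrightarrow>
        prob_space.indep_vars M (\<lambda>_. count_space UNIV) (\<lambda>i \<omega>. card (P \<omega> \<inter> B i)) UNIV)"


section \<open>Measurable enumerations of configurations\<close>

text \<open>
  Pairs of random points are addressed through an enumeration \<open>e\<close> that depends measurably on the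
  configuration only, e.g. by increasing norm with ties broken lexicographically. The points of
  \<open>S\<close> are \<open>e i S\<close> for the indices \<open>i \<in> indices S\<close>; other values of \<open>e\<close> are irrelevant.
\<close>

definition indices :: "'a set \<Rightarrow> nat set" where
  "indices S = {i. infinite S \<or> i < card S}"

definition point_enumeration :: "(nat \<Rightarrow> 'a::euclidean_space set \<Rightarrow> 'a) \<Rightarrow> bool" where
  "point_enumeration e \<longleftrightarrow>
     (\<forall>i. e i \<in> config_space \<rightarrow>\<^sub>M borel) \<and>
     (\<forall>S. locally_finite S \<longrightarrow> bij_betw (\<lambda>i. e i S) (indices S) S)"


section \<open>The bipartite graph\<close>

text \<open>
  A bipartite graph with parts \<open>V\<close> and \<open>U\<close> is given by its set \<open>E \<subseteq> V \<times> U\<close> of connected pairs.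
  The last assumption of \<open>random_connections\<close> says that, conditionally on the
  \<open>\<sigma>\<close>-algebra generated by \<open>V\<close> and \<open>U\<close>, the connections of distinct pairs are independent and
  \<open>(v, u)\<close> is connected with probability \<open>g (v - u)\<close>: as in \<^term>\<open>prob_space.indep_events\<close>, the
  product formula is required for every finite set \<open>F\<close> of pairs.
\<close>

definition connected_event ::
    "'w measure \<Rightarrow> (nat \<Rightarrow> 'a set \<Rightarrow> 'a) \<Rightarrow> ('w \<Rightarrow> 'a set) \<Rightarrow> ('w \<Rightarrow> 'a set) \<Rightarrow>
     ('w \<Rightarrow> ('a \<times> 'a) set) \<Rightarrow> nat \<times> nat \<Rightarrow> 'w set" where
  "connected_event M e V U E = (\<lambda>(i, j). {\<omega> \<in> space M.
     i \<in> indices (V \<omega>) \<and> j \<in> indices (U \<omega>) \<and> (e i (V \<omega>), e j (U \<omega>)) \<in> E \<omega>})"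

definition random_connections ::
    "'w measure \<Rightarrow> ('a::euclidean_space \<Rightarrow> real) \<Rightarrow> ('w \<Rightarrow> 'a set) \<Rightarrow> ('w \<Rightarrow> 'a set) \<Rightarrow>
     ('w \<Rightarrow> ('a \<times> 'a) set) \<Rightarrow> bool" where
  "random_connections M g V U E \<longleftrightarrow>
     (\<forall>\<omega> \<in> space M. E \<omega> \<subseteq> V \<omega> \<times> U \<omega>) \<and>
     (\<exists>e. point_enumeration e \<and>
        (\<forall>p. connected_event M e V U E p \<in> sets M) \<and>
        (\<forall>F. finite F \<longrightarrow>
           (AE \<omega> in M.
              real_cond_exp M
                (vimage_algebra (space M) (\<lambda>\<omega>. (V \<omega>, U \<omega>)) (config_space \<Otimes>\<^sub>M config_space))
                (indicator {\<omega> \<in> space M. \<forall>p \<in> F. \<omega> \<in> connected_event M e V U E p}) \<omega> =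
              (\<Prod>(i, j) \<in> F. if i \<in> indices (V \<omega>) \<and> j \<in> indices (U \<omega>)
                 then g (e i (V \<omega>) - e j (U \<omega>)) else 0))))"


section \<open>The random intersection graph\<close>

text \<open>
  \<open>P\<close> is the Poisson process of vertices before the origin is added.
\<close>

locale random_intersection_model = prob_space M
  for M :: "'w measure" +
  fixes lam mu :: real
    and g :: "'a::euclidean_space \<Rightarrow> real"
    and P V U :: "'w \<Rightarrow> 'a set"
    and E :: "'w \<Rightarrow> ('a \<times> 'a) set"
  assumes poisson_P: "homogeneous_poisson_process M lam P"
    and poisson_U: "homogeneous_poisson_process M mu U"
    and indep_P_U: "indep_var config_space P config_space U"
    and V_eq: "V = (\<lambda>\<omega>. insert 0 (P \<omega>))"
    and connections: "random_connections M g V U E"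

definition intersection_adj :: "'a set \<Rightarrow> ('a \<times> 'a) set \<Rightarrow> 'a \<Rightarrow> 'a \<Rightarrow> bool" where
  "intersection_adj U E v w \<longleftrightarrow> v \<noteq> w \<and> (\<exists>u \<in> U. (v, u) \<in> E \<and> (w, u) \<in> E)"

text \<open>The degree takes the value \<open>\<infinity>\<close> if there are infinitely many neighbours.\<close>

definition intersection_degree :: "'a set \<Rightarrow> 'a set \<Rightarrow> ('a \<times> 'a) set \<Rightarrow> 'a \<Rightarrow> ennreal" where
  "intersection_degree V U E v = emeasure (count_space UNIV) {w \<in> V. intersection_adj U E v w}"

definition nonincreasing_radial :: "('a::real_normed_vector \<Rightarrow> real) \<Rightarrow> bool" where
  "nonincreasing_radial g \<longleftrightarrow>
     (\<forall>x y. norm x = norm y \<longrightarrow> g x = g y) \<and> (\<forall>x y. norm x \<ge> norm y \<longrightarrow> g x \<le> g y)"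

lemma (in random_intersection_model) V_measurable: "V \<in> M \<rightarrow>\<^sub>M config_space"
proof -
  have P: "P \<in> M \<rightarrow>\<^sub>M config_space"
    using poisson_P by (simp add: homogeneous_poisson_process_def)
  have space_config: "space (config_space :: 'a set measure) = {S. locally_finite S}"
    unfolding config_space_def by (rule space_measure_of) auto
  have fin: "locally_finite (P \<omega>)" if "\<omega> \<in> space M" for \<omega>
    using measurable_space[OF P that] space_config by auto
  have lf: "locally_finite (V \<omega>)" if "\<omega> \<in> space M" for \<omega>
    using fin[OF that] by (auto simp: locally_finite_def V_eq Int_insert_left)
  have gen: "{S. locally_finite S \<and> card (S \<inter> B) = n} \<in> sets (config_space :: 'a set measure)"
    if "B \<in> sets borel" "bounded B" for B n
    unfolding config_space_def by (subst sets_measure_of) (use that in auto)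
  have count: "{\<omega> \<in> space M. card (P \<omega> \<inter> B) = n} \<in> sets M"
    if "B \<in> sets borel" "bounded B" for B n
  proof -
    have "P -` {S. locally_finite S \<and> card (S \<inter> B) = n} \<inter> space M \<in> sets M"
      by (rule measurable_sets[OF P gen[OF that]])
    also have "P -` {S. locally_finite S \<and> card (S \<inter> B) = n} \<inter> space M =
        {\<omega> \<in> space M. card (P \<omega> \<inter> B) = n}"
      using fin by auto
    finally show ?thesis .
  qed
  show ?thesis
    unfolding config_space_def
  proof (rule measurable_measure_of)
    show "V \<in> space M \<rightarrow> {S. locally_finite S}"
      using lf by auto
  next
    fix A assume "A \<in> {{S :: 'a set. locally_finite S \<and> card (S \<inter> B) = n} | B n.
      B \<in> sets borel \<and> bounded B}"
    then obtain B n where A: "A = {S. locally_finite S \<and> card (S \<inter> B) = n}"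
      and B: "B \<in> sets borel" "bounded B"
      by auto
    have B': "B - {0} \<in> sets borel" "bounded (B - {0})"
      using B by auto
    have eq: "card (V \<omega> \<inter> B) = card (P \<omega> \<inter> (B - {0})) + (if 0 \<in> B then 1 else 0)"
      if "\<omega> \<in> space M" for \<omega>
    proof -
      have f: "finite (P \<omega> \<inter> (B - {0}))"
        using fin[OF that] B'(2) by (auto simp: locally_finite_def)
      have "V \<omega> \<inter> B = (if 0 \<in> B then insert 0 (P \<omega> \<inter> (B - {0})) else P \<omega> \<inter> (B - {0}))"
        by (auto simp: V_eq)
      then show ?thesis
        using f by (auto simp: card_insert_if)
    qed
    have "V -` A \<inter> space M =
        (if 0 \<in> B then if n = 0 then {} else {\<omega> \<in> space M. card (P \<omega> \<inter> (B - {0})) = n - 1}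
         else {\<omega> \<in> space M. card (P \<omega> \<inter> (B - {0})) = n})"
      using eq lf by (auto simp: A split: if_splits)
    then show "V -` A \<inter> space M \<in> sets M"
      using count[OF B'] by auto
  qed auto
qed

lemma (in random_intersection_model) degree_measurable:
  "(\<lambda>\<omega>. intersection_degree (V \<omega>) (U \<omega>) (E \<omega>) 0) \<in> borel_measurable M"
proof -
  obtain e where e: "point_enumeration e"
    and ev: "\<And>p. connected_event M e V U E p \<in> sets M"
    using connections by (auto simp: random_connections_def)
  have sub: "E \<omega> \<subseteq> V \<omega> \<times> U \<omega>" if "\<omega> \<in> space M" for \<omega>
    using connections that by (auto simp: random_connections_def)
  have U: "U \<in> M \<rightarrow>\<^sub>M config_space"
    using poisson_U by (simp add: homogeneous_poisson_process_def)
  have space_config: "space (config_space :: 'a set measure) = {S. locally_finite S}"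
    unfolding config_space_def by (rule space_measure_of) auto
  have bij: "bij_betw (\<lambda>i. e i S) (indices S) S" if "locally_finite S" for S
    using e that by (auto simp: point_enumeration_def)
  have [measurable]: "(\<lambda>\<omega>. e i (V \<omega>)) \<in> borel_measurable M" for i
    using measurable_compose[OF V_measurable] e by (auto simp: point_enumeration_def)
  define N where "N i = {\<omega> \<in> space M. e i (V \<omega>) \<noteq> 0 \<and> (\<exists>k j. e k (V \<omega>) = 0 \<and>
     \<omega> \<in> connected_event M e V U E (k, j) \<and> \<omega> \<in> connected_event M e V U E (i, j))}" for i
  have [measurable]: "N i \<in> sets M" for i
    using ev unfolding N_def by measurable
  have deg: "intersection_degree (V \<omega>) (U \<omega>) (E \<omega>) 0 = (\<Sum>i. indicator (N i) \<omega>)"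
    if w: "\<omega> \<in> space M" for \<omega>
  proof -
    have bV: "bij_betw (\<lambda>i. e i (V \<omega>)) (indices (V \<omega>)) (V \<omega>)"
      and bU: "bij_betw (\<lambda>i. e i (U \<omega>)) (indices (U \<omega>)) (U \<omega>)"
      using bij measurable_space[OF V_measurable w] measurable_space[OF U w] space_config
      by auto
    let ?W = "{w \<in> V \<omega>. intersection_adj (U \<omega>) (E \<omega>) 0 w}"
    let ?I = "{i. \<omega> \<in> N i}"
    have exV: "\<exists>i \<in> indices (V \<omega>). e i (V \<omega>) = v" if "v \<in> V \<omega>" for v
      using bV that unfolding bij_betw_def by (metis (no_types, lifting) imageE)
    have exU: "\<exists>i \<in> indices (U \<omega>). e i (U \<omega>) = u" if "u \<in> U \<omega>" for u
      using bU that unfolding bij_betw_def by (metis (no_types, lifting) imageE)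
    have I_sub: "?I \<subseteq> indices (V \<omega>)"
      by (auto simp: N_def connected_event_def)
    have img: "(\<lambda>i. e i (V \<omega>)) ` ?I = ?W"
    proof (intro equalityI subsetI)
      fix x assume "x \<in> (\<lambda>i. e i (V \<omega>)) ` ?I"
      then obtain i k j where "x = e i (V \<omega>)" "e i (V \<omega>) \<noteq> 0" "e k (V \<omega>) = 0"
        "(e k (V \<omega>), e j (U \<omega>)) \<in> E \<omega>" "(e i (V \<omega>), e j (U \<omega>)) \<in> E \<omega>"
        by (auto simp: N_def connected_event_def)
      then show "x \<in> ?W"
        using sub[OF w] by (auto simp: intersection_adj_def)
    next
      fix x assume "x \<in> ?W"
      then obtain u where x: "x \<in> V \<omega>" "x \<noteq> 0" "u \<in> U \<omega>" "(0, u) \<in> E \<omega>" "(x, u) \<in> E \<omega>"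
        by (auto simp: intersection_adj_def)
      obtain i where i: "i \<in> indices (V \<omega>)" "e i (V \<omega>) = x"
        using exV x by blast
      obtain k where k: "k \<in> indices (V \<omega>)" "e k (V \<omega>) = 0"
        using exV[of 0] by (auto simp: V_eq)
      obtain j where j: "j \<in> indices (U \<omega>)" "e j (U \<omega>) = u"
        using exU x by blast
      have "\<omega> \<in> N i"
        unfolding N_def connected_event_def mem_Collect_eq case_prod_conv
        using w i j k x by (intro conjI exI[of _ k] exI[of _ j]) auto
      then show "x \<in> (\<lambda>i. e i (V \<omega>)) ` ?I"
        using i by auto
    qed
    have inj: "inj_on (\<lambda>i. e i (V \<omega>)) ?I"
      using bV I_sub by (auto simp: bij_betw_def intro: inj_on_subset)
    have "(\<Sum>i. indicator (N i) \<omega> :: ennreal) = (\<integral>\<^sup>+ i. indicator ?I i \<partial>count_space UNIV)"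
      by (subst nn_integral_count_space_nat) (auto intro!: suminf_cong simp: indicator_def)
    also have "\<dots> = emeasure (count_space UNIV) ?I"
      by simp
    also have "\<dots> = emeasure (count_space UNIV) ?W"
      unfolding img[symmetric]
      using inj by (cases "finite ?I")
        (simp_all add: emeasure_count_space card_image finite_image_iff)
    finally show ?thesis
      by (simp add: intersection_degree_def)
  qed
  show ?thesis
    by (subst measurable_cong[OF deg]) measurable
qed

end

theory Submission
  imports Defs
begin

text \<open>
  Fix a vertex at \<open>y \<noteq> 0\<close>. Given the vertices and the groups, a group at \<open>u\<close> is connected to both \<open>0\<close> and
  \<open>y\<close> with probability \<open>g u * g (y - u)\<close>, and these events are independent for different groups. Hence
  \<open>y\<close> is a neighbour of the origin with conditional probability
  \<open>1 - (\<Prod>u\<in>U. 1 - g u * g (y - u))\<close> (\<open>emeasure_common_group\<close>). The groups form a Poisson process, and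
  its Laplace functional turns the expectation of the product into
  \<open>exp (- (mu * \<integral> g u * g (y - u) du)) = exp (- (mu * f y))\<close> (\<open>expectation_survival\<close>). So \<open>y\<close> is a neighbour with
  probability \<open>1 - exp (- (mu * f y))\<close>, and summing over the vertices, which form a Poisson process
  independent of the groups, gives \<open>lam\<close> times the integral of this probability by Campbell's formula
  (\<open>nn_integral_poisson_process_indep\<close>).

  Connections are described through a measurable enumeration of the points, and only by conditional
  probabilities of finite intersections. Two passages link this to the argument above. First,
  the index of the origin is random, so events are split according to its value, which is determined
  by the vertices (\<open>nn_integral_degree\<close>). Second, finite intersections give finite products of
  \<open>1 - g u * g (y - u)\<close> by inclusion and exclusion, and these decrease to the infinite product
  \<open>survival\<close>, which depends on the configuration alone.
\<close>


section \<open>Infinite products over configurations\<close>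

text \<open>
  If every point \<open>u\<close> of \<open>S\<close> independently succeeds with probability \<open>q u\<close>, this is the probability
  that no point succeeds, i.e. the possibly infinite product \<open>\<Prod>u\<in>S. 1 - q u\<close>. Infima over finite
  subsets do not refer to an order of the points, so that the value depends on the
  configuration alone, and they commute with other decreasing limits.
\<close>

definition survival :: "('a \<Rightarrow> real) \<Rightarrow> 'a set \<Rightarrow> real" where
  "survival q S = (INF F\<in>{F. finite F \<and> F \<subseteq> S}. \<Prod>u\<in>F. 1 - q u)"

lemma prod_one_minus_antimono:
  fixes q :: "'a \<Rightarrow> real"
  assumes "\<And>x. 0 \<le> q x" "\<And>x. q x \<le> 1" "finite B" "A \<subseteq> B"
  shows "(\<Prod>u\<in>B. 1 - q u) \<le> (\<Prod>u\<in>A. 1 - q u)"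
proof -
  have "(\<Prod>u\<in>B. 1 - q u) = (\<Prod>u\<in>A. 1 - q u) * (\<Prod>u\<in>B - A. 1 - q u)"
    using assms(3,4) by (metis mult.commute prod.subset_diff)
  also have "\<dots> \<le> (\<Prod>u\<in>A. 1 - q u) * 1"
    using assms(1,2) by (intro mult_left_mono prod_le_1 prod_nonneg) (auto simp: algebra_simps)
  finally show ?thesis by simp
qed

lemma
  fixes q :: "'a \<Rightarrow> real"
  assumes q: "\<And>x. 0 \<le> q x" "\<And>x. q x \<le> 1"
  shows survival_le_prod: "finite F \<Longrightarrow> F \<subseteq> S \<Longrightarrow> survival q S \<le> (\<Prod>u\<in>F. 1 - q u)"
    and survival_nonneg: "0 \<le> survival q S"
    and survival_le_1: "survival q S \<le> 1"
    and prod_less_survival_add: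
      "\<epsilon> > 0 \<Longrightarrow> \<exists>F. finite F \<and> F \<subseteq> S \<and> (\<Prod>u\<in>F. 1 - q u) < survival q S + \<epsilon>"
proof -
  let ?F = "{F. finite F \<and> F \<subseteq> S}"
  have nn: "0 \<le> (\<Prod>u\<in>F. 1 - q u)" for F
    using q by (intro prod_nonneg) auto
  then have bdd: "bdd_below ((\<lambda>F. \<Prod>u\<in>F. 1 - q u) ` ?F)"
    by (auto intro!: bdd_belowI[of _ 0])
  have ne: "?F \<noteq> {}" by auto
  show le: "survival q S \<le> (\<Prod>u\<in>F. 1 - q u)" if "finite F" "F \<subseteq> S" for F
    unfolding survival_def using bdd that by (intro cINF_lower) auto
  show "0 \<le> survival q S"
    unfolding survival_def using ne nn by (intro cINF_greatest) auto
  show "survival q S \<le> 1"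
    using le[of "{}"] by simp
  show "\<exists>F. finite F \<and> F \<subseteq> S \<and> (\<Prod>u\<in>F. 1 - q u) < survival q S + \<epsilon>" if "\<epsilon> > 0"
    using cINF_less_iff[OF ne bdd, of "survival q S + \<epsilon>"] that
    by (auto simp: survival_def)
qed

lemma survival_eq_prod:
  fixes q :: "'a \<Rightarrow> real"
  assumes q: "\<And>x. 0 \<le> q x" "\<And>x. q x \<le> 1"
    and "finite A" "A \<subseteq> S" "\<And>x. x \<in> S - A \<Longrightarrow> q x = 0"
  shows "survival q S = (\<Prod>u\<in>A. 1 - q u)"
proof (rule antisym)
  show "survival q S \<le> (\<Prod>u\<in>A. 1 - q u)"
    using assms by (intro survival_le_prod) auto
  show "(\<Prod>u\<in>A. 1 - q u) \<le> survival q S"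
    unfolding survival_def
  proof (rule cINF_greatest)
    fix F assume "F \<in> {F. finite F \<and> F \<subseteq> S}"
    then have F: "finite F" "F \<subseteq> S" by auto
    have "(\<Prod>u\<in>A. 1 - q u) \<le> (\<Prod>u\<in>A \<inter> F. 1 - q u)"
      using assms by (intro prod_one_minus_antimono) auto
    also have "\<dots> = (\<Prod>u\<in>F. 1 - q u)"
      using F(2) assms(5) F(1) by (intro prod.mono_neutral_left) (auto simp: subset_iff)
    finally show "(\<Prod>u\<in>A. 1 - q u) \<le> (\<Prod>u\<in>F. 1 - q u)" .
  qed auto
qed

text \<open>
  The finite products decrease in the index set, so their infimum is the limit along every exhaustion
  of \<open>S\<close> by finite sets: each finite subset is eventually contained.
\<close>

lemma prod_tendsto_survival:
  fixes q :: "'a \<Rightarrow> real"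
  assumes q: "\<And>x. 0 \<le> q x" "\<And>x. q x \<le> 1"
    and A: "incseq A" "\<And>n. finite (A n)" "(\<Union>n. A n) = S"
  shows "(\<lambda>n. \<Prod>u\<in>A n. 1 - q u) \<longlonglongrightarrow> survival q S"
proof (rule LIMSEQ_I)
  fix \<epsilon> :: real assume "\<epsilon> > 0"
  then obtain F where F: "finite F" "F \<subseteq> S" "(\<Prod>u\<in>F. 1 - q u) < survival q S + \<epsilon>"
    using prod_less_survival_add[of q \<epsilon> S] q by auto
  have "\<exists>N. F \<subseteq> A N"
    using F(1,2)
  proof (induction F rule: finite_induct)
    case (insert x F)
    then obtain N N' where "F \<subseteq> A N" "x \<in> A N'"
      using A(3) by auto
    then have "insert x F \<subseteq> A (max N N')"
      using incseqD[OF A(1), of N "max N N'"] incseqD[OF A(1), of N' "max N N'"] by auto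
    then show ?case by blast
  qed auto
  then obtain N where N: "F \<subseteq> A N" by auto
  have "norm ((\<Prod>u\<in>A n. 1 - q u) - survival q S) < \<epsilon>" if "n \<ge> N" for n
  proof -
    have "F \<subseteq> A n"
      using N incseqD[OF A(1) that] by auto
    then have "(\<Prod>u\<in>A n. 1 - q u) \<le> (\<Prod>u\<in>F. 1 - q u)"
      using q A by (intro prod_one_minus_antimono) auto
    moreover have "survival q S \<le> (\<Prod>u\<in>A n. 1 - q u)"
      using q A by (intro survival_le_prod) auto
    ultimately show ?thesis
      using F(3) by simp
  qed
  then show "\<exists>N. \<forall>n\<ge>N. norm ((\<Prod>u\<in>A n. 1 - q u) - survival q S) < \<epsilon>"
    by blast
qed

text \<open>
  Monotone convergence for infinite products. It is an exchange of two infima: one finite set \<open>F\<close>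
  brings the product for \<open>q\<close> within \<open>\<epsilon>\<close> of its infimum, and over the fixed finite set \<open>F\<close> the
  convergence of the factors suffices. Through it the Laplace functional passes from simple functions
  to general ones.
\<close>

lemma survival_tendsto:
  fixes q :: "'a \<Rightarrow> real"
  assumes q: "\<And>x. q x \<le> 1"
    and r: "\<And>n x. 0 \<le> r n x" "\<And>x. incseq (\<lambda>n. r n x)" "\<And>x. (\<lambda>n. r n x) \<longlonglongrightarrow> q x"
  shows "(\<lambda>n. survival (r n) S) \<longlonglongrightarrow> survival q S"
proof (rule LIMSEQ_I)
  fix \<epsilon> :: real assume e: "\<epsilon> > 0"
  have rq: "r n x \<le> q x" for n x
    using incseq_le[OF r(2) r(3)] .
  have r1: "r n x \<le> 1" for n x
    using rq[of n x] q[of x] by simp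
  have q0: "0 \<le> q x" for x
    using rq[of 0 x] r(1)[of 0 x] by simp
  obtain F where F: "finite F" "F \<subseteq> S" "(\<Prod>u\<in>F. 1 - q u) < survival q S + \<epsilon>"
    using prod_less_survival_add[of q \<epsilon> S] q q0 e by auto
  have "(\<lambda>n. \<Prod>u\<in>F. 1 - r n u) \<longlonglongrightarrow> (\<Prod>u\<in>F. 1 - q u)"
    by (intro tendsto_prod tendsto_diff tendsto_const r(3))
  from order_tendstoD(2)[OF this F(3)]
  obtain N where N: "(\<Prod>u\<in>F. 1 - r n u) < survival q S + \<epsilon>" if "n \<ge> N" for n
    by (auto simp: eventually_sequentially)
  have low: "survival q S \<le> survival (r n) S" for n
    unfolding survival_def[of "r n"]
  proof (rule cINF_greatest)
    fix F assume "F \<in> {F. finite F \<and> F \<subseteq> S}"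
    then have "survival q S \<le> (\<Prod>u\<in>F. 1 - q u)"
      using q q0 by (intro survival_le_prod) auto
    also have "\<dots> \<le> (\<Prod>u\<in>F. 1 - r n u)"
      using q rq by (intro prod_mono) auto
    finally show "survival q S \<le> (\<Prod>u\<in>F. 1 - r n u)" .
  qed auto
  have "norm (survival (r n) S - survival q S) < \<epsilon>" if "n \<ge> N" for n
    using N[OF that] low[of n] survival_le_prod[of "r n" F S] r(1) r1 F by auto
  then show "\<exists>N. \<forall>n\<ge>N. norm (survival (r n) S - survival q S) < \<epsilon>"
    by blast
qed


section \<open>Measurability on the space of configurations\<close>

lemma space_config_space: "space config_space = {S. locally_finite S}"
  unfolding config_space_def by (rule space_measure_of) auto

lemma finite_Int_bounded: "locally_finite S \<Longrightarrow> bounded B \<Longrightarrow> finite (S \<inter> B)"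
  by (simp add: locally_finite_def)

lemma measurable_card_Int:
  fixes B :: "'a::euclidean_space set"
  assumes "B \<in> sets borel" "bounded B"
  shows "(\<lambda>S. card (S \<inter> B)) \<in> config_space \<rightarrow>\<^sub>M count_space UNIV"
proof (rule measurable_count_space_eq2_countable[THEN iffD2], safe)
  fix n
  have "(\<lambda>S. card (S \<inter> B)) -` {n} \<inter> space config_space = {S. locally_finite S \<and> card (S \<inter> B) = n}"
    by (auto simp: space_config_space)
  also have "\<dots> \<in> sets config_space"
    unfolding config_space_def by (subst sets_measure_of) (use assms in auto)
  finally show "(\<lambda>S. card (S \<inter> B)) -` {n} \<inter> space config_space \<in> sets config_space" .
qed auto

text \<open>
  The \<open>\<sigma>\<close>-algebra of \<^const>\<open>config_space\<close> only knows the numbers of points in bounded sets, and this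
  expresses the index set through them.
\<close>

lemma mem_indices_iff_card_ball:
  fixes S :: "'a::euclidean_space set"
  assumes "locally_finite S"
  shows "i \<in> indices S \<longleftrightarrow> (\<exists>n::nat. i < card (S \<inter> ball 0 (real n)))"
proof
  assume "i \<in> indices S"
  then obtain F where F: "finite F" "F \<subseteq> S" "card F = Suc i"
    unfolding indices_def
    by (metis (mono_tags, lifting) infinite_arbitrarily_large mem_Collect_eq obtain_subset_with_card_n Suc_leI)
  then obtain r where "F \<subseteq> ball 0 r"
    using bounded_subset_ballD[OF finite_imp_bounded[OF F(1)], of 0] by auto
  moreover obtain n :: nat where "r \<le> real n"
    using real_arch_simple by blast
  ultimately have "F \<subseteq> S \<inter> ball 0 (real n)"
    using F(2) by auto
  from card_mono[OF finite_Int_bounded[OF assms bounded_ball] this]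
  show "\<exists>n. i < card (S \<inter> ball 0 (real n))"
    using F(3) by (auto simp: Suc_le_eq)
next
  assume "\<exists>n. i < card (S \<inter> ball 0 (real n))"
  then show "i \<in> indices S"
    unfolding indices_def
    by (metis (no_types, lifting) Int_lower1 card_mono mem_Collect_eq order_less_le_trans)
qed

lemma measurable_mem_indices [measurable]:
  "Measurable.pred config_space (\<lambda>S :: 'a::euclidean_space set. i \<in> indices S)"
proof -
  have [measurable]: "(\<lambda>S. card (S \<inter> ball (0::'a) (real n))) \<in> config_space \<rightarrow>\<^sub>M count_space UNIV" for n
    by (intro measurable_card_Int) auto
  have "{S \<in> space config_space. i \<in> indices S} =
      {S \<in> space config_space. \<exists>n. i < card (S \<inter> ball (0::'a) (real n))}"
    using mem_indices_iff_card_ball by (auto simp: space_config_space)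
  also have "\<dots> \<in> sets config_space"
    by measurable
  finally show ?thesis by (simp add: pred_def)
qed

lemma nn_integral_count_space_enumeration:
  assumes "point_enumeration e" "locally_finite S"
  shows "(\<integral>\<^sup>+ x. \<phi> x \<partial>count_space S) = (\<Sum>i. indicator (indices S) i * \<phi> (e i S))"
proof -
  have "(\<integral>\<^sup>+ x. \<phi> x \<partial>count_space S) = (\<integral>\<^sup>+ i. \<phi> (e i S) \<partial>count_space (indices S))"
    using assms by (intro nn_integral_bij_count_space[symmetric]) (auto simp: point_enumeration_def)
  also have "\<dots> = (\<integral>\<^sup>+ i. \<phi> (e i S) * indicator (indices S) i \<partial>count_space UNIV)"
    by (simp add: nn_integral_restrict_space[symmetric] restrict_count_space)
  also have "\<dots> = (\<Sum>i. indicator (indices S) i * \<phi> (e i S))"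
    by (simp add: nn_integral_count_space_nat mult.commute)
  finally show ?thesis .
qed

lemma prod_enumeration_tendsto_survival:
  fixes q :: "'a::euclidean_space \<Rightarrow> real"
  assumes e: "point_enumeration e" "locally_finite S"
    and q: "\<And>x. 0 \<le> q x" "\<And>x. q x \<le> 1"
  shows "(\<lambda>n. \<Prod>j<n. 1 - (if j \<in> indices S then q (e j S) else 0)) \<longlonglongrightarrow> survival q S"
proof -
  have bij: "bij_betw (\<lambda>i. e i S) (indices S) S"
    using e by (auto simp: point_enumeration_def)
  define A where "A n = (\<lambda>i. e i S) ` (indices S \<inter> {..<n})" for n
  have "(\<Prod>j<n. 1 - (if j \<in> indices S then q (e j S) else 0)) = (\<Prod>u\<in>A n. 1 - q u)" for n
  proof -
    have "(\<Prod>u\<in>A n. 1 - q u) = (\<Prod>j\<in>indices S \<inter> {..<n}. 1 - q (e j S))"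
      unfolding A_def using bij
      by (subst prod.reindex) (auto simp: bij_betw_def intro: inj_on_subset)
    also have "\<dots> = (\<Prod>j<n. 1 - (if j \<in> indices S then q (e j S) else 0))"
      by (intro prod.mono_neutral_cong_left) auto
    finally show ?thesis by simp
  qed
  moreover have "(\<lambda>n. \<Prod>u\<in>A n. 1 - q u) \<longlonglongrightarrow> survival q S"
  proof (rule prod_tendsto_survival[OF q])
    show "incseq A"
      by (auto simp: A_def incseq_def)
    show "(\<Union>n. A n) = S"
      using bij by (auto simp: A_def bij_betw_def)
  qed (auto simp: A_def)
  ultimately show ?thesis by simp
qed

text \<open>
  Joint measurability in a parameter and the configuration; it is needed to integrate over a vertex
  and the group process separately. The measurable enumeration enters here: it writes the product as
  a limit of measurable finite products.
\<close>

lemma measurable_survival: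
  fixes q :: "'b \<Rightarrow> 'a::euclidean_space \<Rightarrow> real" and e :: "nat \<Rightarrow> 'a set \<Rightarrow> 'a"
  assumes e: "point_enumeration e"
    and q: "\<And>v x. 0 \<le> q v x" "\<And>v x. q v x \<le> 1"
    and qm: "(\<lambda>(v, x). q v x) \<in> borel_measurable (N \<Otimes>\<^sub>M borel)"
  shows "(\<lambda>(v, S). survival (q v) S) \<in> borel_measurable (N \<Otimes>\<^sub>M config_space)"
proof (rule borel_measurable_LIMSEQ_real)
  fix z assume "z \<in> space (N \<Otimes>\<^sub>M (config_space :: 'a set measure))"
  then have "locally_finite (snd z)"
    by (auto simp: space_pair_measure space_config_space)
  from prod_enumeration_tendsto_survival[OF e this q[of "fst z"]]
  show "(\<lambda>n. \<Prod>j<n. 1 - (if j \<in> indices (snd z) then q (fst z) (e j (snd z)) else 0))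
      \<longlonglongrightarrow> (case z of (v, S) \<Rightarrow> survival (q v) S)"
    by (simp add: case_prod_beta)
next
  fix n
  have [measurable]: "e j \<in> config_space \<rightarrow>\<^sub>M borel" for j
    using e by (auto simp: point_enumeration_def)
  have [measurable]: "(\<lambda>z. q (fst z) (e j (snd z))) \<in> borel_measurable (N \<Otimes>\<^sub>M config_space)" for j
    using measurable_compose[OF _ qm, of "\<lambda>z. (fst z, e j (snd z))" "N \<Otimes>\<^sub>M config_space"] by simp
  show "(\<lambda>z. \<Prod>j<n. 1 - (if j \<in> indices (snd z) then q (fst z) (e j (snd z)) else 0))
      \<in> borel_measurable (N \<Otimes>\<^sub>M config_space)"
    by measurable
qed


section \<open>The Laplace functional and Campbell's formula of the Poisson process\<close>

text \<open>
  Written out in order to cover the rate 0, which counts in sets of volume 0 have.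
\<close>

definition poisson_variable :: "'w measure \<Rightarrow> real \<Rightarrow> ('w \<Rightarrow> nat) \<Rightarrow> bool" where
  "poisson_variable M a N \<longleftrightarrow> N \<in> M \<rightarrow>\<^sub>M count_space UNIV \<and>
     (\<forall>n. measure M {\<omega> \<in> space M. N \<omega> = n} = a ^ n / fact n * exp (- a))"

context prob_space begin

lemma nn_integral_poisson_variable:
  assumes N: "poisson_variable M a N" and a: "0 \<le> a"
  shows "(\<integral>\<^sup>+ \<omega>. ennreal (\<phi> (N \<omega>)) \<partial>M) = (\<Sum>n. ennreal (\<phi> n * (a ^ n / fact n * exp (- a))))"
proof -
  have [measurable]: "N \<in> M \<rightarrow>\<^sub>M count_space UNIV"
    using N by (simp add: poisson_variable_def)
  have "ennreal (\<phi> (N \<omega>)) = (\<Sum>n. ennreal (\<phi> n) * indicator {\<omega> \<in> space M. N \<omega> = n} \<omega>)"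
    if "\<omega> \<in> space M" for \<omega>
    using that by (subst suminf_finite[of "{N \<omega>}"]) (auto simp: indicator_def)
  then have "(\<integral>\<^sup>+ \<omega>. ennreal (\<phi> (N \<omega>)) \<partial>M) =
      (\<integral>\<^sup>+ \<omega>. (\<Sum>n. ennreal (\<phi> n) * indicator {\<omega> \<in> space M. N \<omega> = n} \<omega>) \<partial>M)"
    by (intro nn_integral_cong) auto
  also have "\<dots> = (\<Sum>n. ennreal (\<phi> n) * emeasure M {\<omega> \<in> space M. N \<omega> = n})"
    by (subst nn_integral_suminf) (auto simp: nn_integral_cmult_indicator)
  also have "\<dots> = (\<Sum>n. ennreal (\<phi> n * (a ^ n / fact n * exp (- a))))"
    using N a
    by (intro suminf_cong)
      (simp add: poisson_variable_def emeasure_eq_measure flip: ennreal_mult'')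
  finally show ?thesis .
qed

lemma expectation_power_poisson_variable:
  assumes N: "poisson_variable M a N" and a: "0 \<le> a" and z: "0 \<le> z" "z \<le> 1"
  shows "expectation (\<lambda>\<omega>. z ^ N \<omega>) = exp (- (1 - z) * a)"
proof -
  have [measurable]: "N \<in> M \<rightarrow>\<^sub>M count_space UNIV"
    using N by (simp add: poisson_variable_def)
  have "(\<lambda>n. exp (- a) * ((z * a) ^ n /\<^sub>R fact n)) sums (exp (- a) * exp (z * a))"
    by (intro sums_mult exp_converges)
  then have s: "(\<lambda>n. z ^ n * (a ^ n / fact n * exp (- a))) sums exp (- (1 - z) * a)"
    by (simp add: power_mult_distrib divide_inverse exp_add[symmetric] algebra_simps)
  have "(\<integral>\<^sup>+ \<omega>. ennreal (z ^ N \<omega>) \<partial>M) = (\<Sum>n. ennreal (z ^ n * (a ^ n / fact n * exp (- a))))"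
    using nn_integral_poisson_variable[OF N a, of "\<lambda>n. z ^ n"] .
  also have "\<dots> = ennreal (exp (- (1 - z) * a))"
    using s z a by (intro suminf_ennreal_eq) auto
  finally show ?thesis
    using z by (intro integral_eq_nn_integral[THEN trans]) auto
qed

lemma nn_integral_poisson_variable_mean:
  assumes N: "poisson_variable M a N" and a: "0 \<le> a"
  shows "(\<integral>\<^sup>+ \<omega>. of_nat (N \<omega>) \<partial>M) = ennreal a"
proof -
  have "(\<lambda>n. a * exp (- a) * (a ^ n /\<^sub>R fact n)) sums (a * exp (- a) * exp a)"
    by (intro sums_mult exp_converges)
  also have "(\<lambda>n. a * exp (- a) * (a ^ n /\<^sub>R fact n)) =
      (\<lambda>n. real (Suc n) * (a ^ Suc n / fact (Suc n) * exp (- a)))"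
    by (auto simp: field_simps simp del: of_nat_Suc)
  also have "a * exp (- a) * exp a = a"
    by (simp add: exp_minus)
  finally have s: "(\<lambda>n. real n * (a ^ n / fact n * exp (- a))) sums a"
    by (subst (asm) sums_Suc_iff) simp
  have "(\<integral>\<^sup>+ \<omega>. of_nat (N \<omega>) \<partial>M) = (\<integral>\<^sup>+ \<omega>. ennreal (real (N \<omega>)) \<partial>M)"
    by (simp add: ennreal_of_nat_eq_real_of_nat)
  also have "\<dots> = (\<Sum>n. ennreal (real n * (a ^ n / fact n * exp (- a))))"
    using nn_integral_poisson_variable[OF N a, of real] .
  also have "\<dots> = ennreal a"
    using s a by (intro suminf_ennreal_eq) auto
  finally show ?thesis .
qed

lemma poisson_variable_card:
  assumes P: "homogeneous_poisson_process M \<gamma> P" and B: "B \<in> sets borel" "bounded B"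
  shows "poisson_variable M (\<gamma> * measure lborel B) (\<lambda>\<omega>. card (P \<omega> \<inter> B))"
  using P B measurable_compose[of P M config_space "\<lambda>S. card (S \<inter> B)" "count_space UNIV"]
    measurable_card_Int[OF B]
  unfolding poisson_variable_def homogeneous_poisson_process_def by auto

text \<open>
  If \<open>q\<close> takes finitely many values, the points of \<open>U\<close> can be grouped by the value of \<open>q\<close>, which
  gives a finite product of powers \<open>(1 - c) ^ N\<close>, where \<open>N\<close> counts the points in the level set of \<open>c\<close>.
  These counts are independent Poisson variables, so the expectation is a product of Poisson
  generating functions. The value \<open>c = 0\<close> is left out because its level set is unbounded and
  its factor is 1.
\<close>

lemma expectation_survival_simple:
  fixes q :: "'b::euclidean_space \<Rightarrow> real"
  assumes U: "homogeneous_poisson_process M \<gamma> U" and \<gamma>: "0 \<le> \<gamma>"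
    and q: "\<And>x. 0 \<le> q x" "\<And>x. q x \<le> 1"
    and sf: "simple_function borel q"
    and B: "bounded B" "\<And>x. x \<notin> B \<Longrightarrow> q x = 0"
  shows "expectation (\<lambda>\<omega>. survival q (U \<omega>)) = exp (- \<gamma> * (LINT x|lborel. q x))"
    and "(\<lambda>\<omega>. survival q (U \<omega>)) \<in> borel_measurable M"
proof -
  define C where "C = range q - {0}"
  have finC: "finite C"
    using sf by (auto simp: C_def simple_function_def)
  define L where "L c = q -` {c}" for c
  have L: "L c \<in> sets borel" "bounded (L c)" if "c \<in> C" for c
  proof -
    show "L c \<in> sets borel"
      using simple_functionD(2)[OF sf, of "{c}"] by (simp add: L_def)
    show "bounded (L c)"
      using that B by (intro bounded_subset[OF B(1)]) (auto simp: L_def C_def)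
  qed
  have lf: "locally_finite (U \<omega>)" if "\<omega> \<in> space M" for \<omega>
    using U measurable_space[of U M config_space \<omega>] that
    by (auto simp: homogeneous_poisson_process_def space_config_space)
  have surv: "survival q (U \<omega>) = (\<Prod>c\<in>C. (1 - c) ^ card (U \<omega> \<inter> L c))" if "\<omega> \<in> space M" for \<omega>
  proof -
    define A where "A = {u \<in> U \<omega>. q u \<noteq> 0}"
    have "finite A"
      using finite_Int_bounded[OF lf[OF that] B(1)] B(2)
      by (rule_tac finite_subset) (auto simp: A_def)
    then have "survival q (U \<omega>) = (\<Prod>u\<in>A. 1 - q u)"
      using q by (intro survival_eq_prod) (auto simp: A_def)
    also have "\<dots> = (\<Prod>c\<in>C. \<Prod>u\<in>{u \<in> A. q u = c}. 1 - q u)"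
      using \<open>finite A\<close> finC by (intro prod.group[symmetric]) (auto simp: A_def C_def)
    also have "\<dots> = (\<Prod>c\<in>C. (1 - c) ^ card (U \<omega> \<inter> L c))"
    proof (intro prod.cong refl)
      fix c assume "c \<in> C"
      then have "{u \<in> A. q u = c} = U \<omega> \<inter> L c"
        by (auto simp: A_def C_def L_def)
      then show "(\<Prod>u\<in>{u \<in> A. q u = c}. 1 - q u) = (1 - c) ^ card (U \<omega> \<inter> L c)"
        by (subst prod.cong[of _ "U \<omega> \<inter> L c" _ "\<lambda>_. 1 - c"]) (auto simp: L_def)
    qed
    finally show ?thesis .
  qed
  obtain h where h: "bij_betw h {..<card C} C"
    using ex_bij_betw_nat_finite[OF finC] by (auto simp: atLeast0LessThan)
  \<comment> \<open>Independence of counts is assumed for sequences of sets, so the level sets are extended by \<open>{}\<close>.\<close>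
  define B' where "B' i = (if i < card C then L (h i) else {})" for i
  have hC: "h i \<in> C" if "i < card C" for i
    using h that by (auto simp: bij_betw_def)
  have B': "B' i \<in> sets borel" "bounded (B' i)" for i
    using L hC by (auto simp: B'_def)
  have "disjoint_family B'"
    using h by (auto simp: disjoint_family_on_def B'_def L_def bij_betw_def inj_on_def)
  then have "indep_vars (\<lambda>_. count_space UNIV) (\<lambda>i \<omega>. card (U \<omega> \<inter> B' i)) UNIV"
    using U B' by (auto simp: homogeneous_poisson_process_def)
  then have "indep_vars (\<lambda>_. count_space UNIV) (\<lambda>i \<omega>. card (U \<omega> \<inter> B' i)) {..<card C}"
    by (rule indep_vars_subset) auto
  then have ind: "indep_vars (\<lambda>_. borel) (\<lambda>i \<omega>. (1 - h i) ^ card (U \<omega> \<inter> B' i)) {..<card C}"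
    by (rule indep_vars_compose2[where Y = "\<lambda>i n. (1 - h i) ^ n"]) auto
  have c01: "0 \<le> c" "c \<le> 1" if "c \<in> C" for c
    using that q by (auto simp: C_def)
  have pv: "poisson_variable M (\<gamma> * measure lborel (B' i)) (\<lambda>\<omega>. card (U \<omega> \<inter> B' i))" for i
    using poisson_variable_card[OF U B'] .
  have [measurable]: "(\<lambda>\<omega>. card (U \<omega> \<inter> B' i)) \<in> M \<rightarrow>\<^sub>M count_space UNIV" for i
    using pv[of i] by (simp add: poisson_variable_def)
  have surv': "survival q (U \<omega>) = (\<Prod>i<card C. (1 - h i) ^ card (U \<omega> \<inter> B' i))" if "\<omega> \<in> space M" for \<omega>
    unfolding surv[OF that] using h
    by (subst prod.reindex_bij_betw[OF h, symmetric]) (simp add: B'_def)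
  show "(\<lambda>\<omega>. survival q (U \<omega>)) \<in> borel_measurable M"
    by (subst measurable_cong[OF surv']) auto
  have "expectation (\<lambda>\<omega>. survival q (U \<omega>)) =
      expectation (\<lambda>\<omega>. \<Prod>i<card C. (1 - h i) ^ card (U \<omega> \<inter> B' i))"
    by (intro Bochner_Integration.integral_cong surv' refl)
  also have "\<dots> = (\<Prod>i<card C. expectation (\<lambda>\<omega>. (1 - h i) ^ card (U \<omega> \<inter> B' i)))"
  proof (rule indep_vars_lebesgue_integral[OF _ ind])
    fix i assume "i \<in> {..<card C}"
    then show "integrable M (\<lambda>\<omega>. (1 - h i) ^ card (U \<omega> \<inter> B' i))"
      using c01[OF hC, of i]
      by (intro integrable_const_bound[where B = 1] AE_I2) (auto intro!: power_le_one)
  qed auto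
  also have "\<dots> = (\<Prod>i<card C. exp (- \<gamma> * (h i * measure lborel (L (h i)))))"
  proof (intro prod.cong refl)
    fix i assume "i \<in> {..<card C}"
    then show "expectation (\<lambda>\<omega>. (1 - h i) ^ card (U \<omega> \<inter> B' i)) =
        exp (- \<gamma> * (h i * measure lborel (L (h i))))"
      using expectation_power_poisson_variable[OF pv[of i], of "1 - h i"] c01[OF hC, of i] \<gamma>
      by (simp add: B'_def mult_ac)
  qed
  also have "\<dots> = (\<Prod>c\<in>C. exp (- \<gamma> * (c * measure lborel (L c))))"
    by (rule prod.reindex_bij_betw[OF h])
  also have "\<dots> = exp (- \<gamma> * (\<Sum>c\<in>C. c * measure lborel (L c)))"
    using finC by (simp add: exp_sum[symmetric] sum_distrib_left sum_negf)
  also have "(\<Sum>c\<in>C. c * measure lborel (L c)) = (LINT x|lborel. q x)"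
  proof -
    have fin: "emeasure lborel (L c) < \<infinity>" if "c \<in> C" for c
      using emeasure_bounded_finite[OF L(2)[OF that]] .
    have "(LINT x|lborel. q x) = (LINT x|lborel. (\<Sum>c\<in>C. c * indicator (L c) x))"
    proof (intro Bochner_Integration.integral_cong refl)
      fix x
      have "(\<Sum>c\<in>C. c * indicator (L c) x) = (\<Sum>c\<in>C. if c = q x then c else 0)"
        by (intro sum.cong) (auto simp: L_def indicator_def)
      also have "\<dots> = q x"
        using finC by (auto simp: sum.delta C_def)
      finally show "q x = (\<Sum>c\<in>C. c * indicator (L c) x)" by simp
    qed
    also have "\<dots> = (\<Sum>c\<in>C. (LINT x|lborel. c * indicator (L c) x))"
      using L fin by (intro Bochner_Integration.integral_sum integrable_mult_right) (auto simp: integrable_indicator_iff)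
    also have "\<dots> = (\<Sum>c\<in>C. c * measure lborel (L c))"
      by simp
    finally show ?thesis by simp
  qed
  finally show "expectation (\<lambda>\<omega>. survival q (U \<omega>)) = exp (- \<gamma> * (LINT x|lborel. q x))" .
qed

text \<open>
  The Laplace functional of the Poisson process in product form. Truncating increasing simple
  functions to growing balls reduces it to simple functions of bounded support; the product then
  converges by monotonicity and both sides by dominated convergence.
\<close>

lemma expectation_survival:
  fixes q :: "'b::euclidean_space \<Rightarrow> real"
  assumes U: "homogeneous_poisson_process M \<gamma> U" and \<gamma>: "0 \<le> \<gamma>"
    and q: "\<And>x. 0 \<le> q x" "\<And>x. q x \<le> 1"
    and int: "integrable lborel q"
  shows "expectation (\<lambda>\<omega>. survival q (U \<omega>)) = exp (- \<gamma> * (LINT x|lborel. q x))"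
proof -
  have "q \<in> borel_measurable borel"
    using int by auto
  from borel_measurable_implies_simple_function_sequence_real[OF this q(1)]
  obtain s where s: "incseq s" "\<And>i. simple_function borel (s i)"
    "\<And>x. bdd_above (range (\<lambda>i. s i x))" "\<And>i x. 0 \<le> s i x" "q = (SUP i. s i)"
    by blast
  have slim: "(\<lambda>i. s i x) \<longlonglongrightarrow> q x" for x
  proof -
    have "q x = (SUP i. s i x)"
      unfolding s(5) by (simp add: image_comp)
    then show ?thesis
      using LIMSEQ_incseq_SUP[OF s(3), of x] s(1) by (auto simp: incseq_def le_fun_def)
  qed
  define r where "r n x = s n x * indicator (ball 0 (real n)) x" for n x
  have r0: "0 \<le> r n x" for n x
    using s(4) by (simp add: r_def)
  have rinc: "incseq (\<lambda>n. r n x)" for x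
    using s(1,4) unfolding r_def incseq_def le_fun_def
    by (auto simp: indicator_def intro: order_trans split: if_splits)
  have rlim: "(\<lambda>n. r n x) \<longlonglongrightarrow> q x" for x
  proof -
    obtain N :: nat where N: "norm x < real N"
      using reals_Archimedean2 by blast
    have "eventually (\<lambda>n. s n x = r n x) sequentially"
      using eventually_ge_at_top[of N]
      by eventually_elim (use N in \<open>auto simp: r_def indicator_def\<close>)
    from tendsto_cong[OF this, of "q x"] slim[of x] show ?thesis by simp
  qed
  have rq: "r n x \<le> q x" for n x
    using incseq_le[OF rinc rlim] .
  have r1: "r n x \<le> 1" for n x
    using rq[of n x] q(2)[of x] by simp
  have rsf: "simple_function borel (r n)" for n
    unfolding r_def using s(2) by (intro simple_function_mult simple_function_indicator) auto
  have *: "expectation (\<lambda>\<omega>. survival (r n) (U \<omega>)) = exp (- \<gamma> * (LINT x|lborel. r n x))"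
      "(\<lambda>\<omega>. survival (r n) (U \<omega>)) \<in> borel_measurable M" for n
    using expectation_survival_simple[OF U \<gamma> r0 r1 rsf, of "ball 0 (real n)"]
    by (auto simp: r_def)
  have lim: "(\<lambda>n. survival (r n) S) \<longlonglongrightarrow> survival q S" for S
    using q(2) r0 rinc rlim by (rule survival_tendsto)
  have "(\<lambda>n. expectation (\<lambda>\<omega>. survival (r n) (U \<omega>))) \<longlonglongrightarrow> expectation (\<lambda>\<omega>. survival q (U \<omega>))"
  proof (rule integral_dominated_convergence[where w = "\<lambda>_. 1"])
    show "(\<lambda>\<omega>. survival q (U \<omega>)) \<in> borel_measurable M"
      using lim *(2) by (rule borel_measurable_LIMSEQ_real)
    show "AE \<omega> in M. norm (survival (r n) (U \<omega>)) \<le> 1" for n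
      using survival_nonneg[of "r n"] survival_le_1[of "r n"] r0 r1 by (intro AE_I2) auto
  qed (use lim * in auto)
  moreover have "(\<lambda>n. LINT x|lborel. r n x) \<longlonglongrightarrow> (LINT x|lborel. q x)"
  proof (rule integral_dominated_convergence[where w = q])
    show "r n \<in> borel_measurable lborel" for n
      using borel_measurable_simple_function[OF rsf] by simp
    show "AE x in lborel. norm (r n x) \<le> q x" for n
      using r0 rq by auto
  qed (use int rlim in auto)
  then have "(\<lambda>n. exp (- \<gamma> * (LINT x|lborel. r n x))) \<longlonglongrightarrow> exp (- \<gamma> * (LINT x|lborel. q x))"
    by (intro tendsto_intros)
  ultimately show ?thesis
    using LIMSEQ_unique unfolding *(1) by blast
qed

text \<open>
  Campbell's formula. As a function of \<open>\<phi>\<close>, the left hand side divided by \<open>\<gamma>\<close> is integration with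
  respect to a measure \<open>\<nu>\<close>, the normalised intensity measure of the process. A Poisson variable has
  its rate as mean, so \<open>\<nu>\<close> gives every box its volume and must be Lebesgue measure.
\<close>

lemma nn_integral_poisson_process:
  fixes P :: "'a \<Rightarrow> 'b::euclidean_space set" and e :: "nat \<Rightarrow> 'b set \<Rightarrow> 'b"
  assumes P: "homogeneous_poisson_process M \<gamma> P" and \<gamma>: "0 < \<gamma>"
    and e: "point_enumeration e"
    and \<phi>: "\<phi> \<in> borel_measurable borel"
  shows "(\<integral>\<^sup>+ \<omega>. (\<integral>\<^sup>+ x. \<phi> x \<partial>count_space (P \<omega>)) \<partial>M) = ennreal \<gamma> * (\<integral>\<^sup>+ x. \<phi> x \<partial>lborel)"
proof -
  have Pm [measurable]: "P \<in> M \<rightarrow>\<^sub>M config_space"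
    using P by (simp add: homogeneous_poisson_process_def)
  have lf: "locally_finite (P \<omega>)" if "\<omega> \<in> space M" for \<omega>
    using measurable_space[OF Pm that] by (simp add: space_config_space)
  have em [measurable]: "(\<lambda>\<omega>. e i (P \<omega>)) \<in> borel_measurable M" for i
    using measurable_compose[OF Pm] e by (auto simp: point_enumeration_def)
  have im [measurable]: "Measurable.pred M (\<lambda>\<omega>. i \<in> indices (P \<omega>))" for i
    by measurable
  have [measurable]: "(\<lambda>z. e (snd z) (P (fst z))) \<in> borel_measurable (M \<Otimes>\<^sub>M count_space UNIV)"
    by (rule measurable_compose_countable[where f = "\<lambda>i z. e i (P (fst z))" and g = snd]) auto
  have [measurable]: "Measurable.pred (M \<Otimes>\<^sub>M count_space UNIV) (\<lambda>z. snd z \<in> indices (P (fst z)))"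
    by (rule measurable_compose_countable[where f = "\<lambda>i z. i \<in> indices (P (fst z))" and g = snd]) auto
  interpret C: sigma_finite_measure "count_space (UNIV :: nat set)"
    by (rule sigma_finite_measure_count_space)
  \<comment> \<open>The image of \<open>M\<close> times counting measure under the enumeration of the points.\<close>
  define \<nu> :: "'b measure" where "\<nu> = distr (density (M \<Otimes>\<^sub>M count_space UNIV)
      (\<lambda>z. indicator (indices (P (fst z))) (snd z) / ennreal \<gamma>)) borel (\<lambda>z. e (snd z) (P (fst z)))"
  have ind: "(\<lambda>z. indicator (indices (P (fst z))) (snd z) :: ennreal) \<in> borel_measurable (M \<Otimes>\<^sub>M count_space UNIV)"
    unfolding indicator_def by measurable
  have \<nu>: "(\<integral>\<^sup>+ x. \<psi> x \<partial>\<nu>) = (\<integral>\<^sup>+ \<omega>. (\<integral>\<^sup>+ x. \<psi> x \<partial>count_space (P \<omega>)) \<partial>M) / ennreal \<gamma>"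
    if [measurable]: "\<psi> \<in> borel_measurable borel" for \<psi> :: "'b \<Rightarrow> ennreal"
  proof -
    have "(\<integral>\<^sup>+ x. \<psi> x \<partial>\<nu>) = (\<integral>\<^sup>+ z. indicator (indices (P (fst z))) (snd z) / ennreal \<gamma> *
        \<psi> (e (snd z) (P (fst z))) \<partial>(M \<Otimes>\<^sub>M count_space UNIV))"
      unfolding \<nu>_def using ind by (simp add: nn_integral_distr nn_integral_density)
    also have "\<dots> = (\<integral>\<^sup>+ z. indicator (indices (P (fst z))) (snd z) *
        \<psi> (e (snd z) (P (fst z))) / ennreal \<gamma> \<partial>(M \<Otimes>\<^sub>M count_space UNIV))"
      by (simp add: divide_ennreal_def mult_ac)
    also have "\<dots> = (\<integral>\<^sup>+ \<omega>. (\<integral>\<^sup>+ i. indicator (indices (P \<omega>)) i * \<psi> (e i (P \<omega>)) / ennreal \<gamma>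
        \<partial>count_space UNIV) \<partial>M)"
      using ind by (subst C.nn_integral_fst[symmetric]) auto
    also have "\<dots> = (\<integral>\<^sup>+ \<omega>. (\<integral>\<^sup>+ x. \<psi> x \<partial>count_space (P \<omega>)) / ennreal \<gamma> \<partial>M)"
      by (intro nn_integral_cong)
        (simp add: nn_integral_count_space_enumeration[OF e lf] nn_integral_divide nn_integral_count_space_nat)
    also have "\<dots> = (\<integral>\<^sup>+ \<omega>. (\<integral>\<^sup>+ x. \<psi> x \<partial>count_space (P \<omega>)) \<partial>M) / ennreal \<gamma>"
    proof (rule nn_integral_divide)
      have "(\<lambda>\<omega>. \<Sum>i. indicator (indices (P \<omega>)) i * \<psi> (e i (P \<omega>))) \<in> borel_measurable M"
        unfolding indicator_def by measurable
      then show "(\<lambda>\<omega>. \<integral>\<^sup>+ x. \<psi> x \<partial>count_space (P \<omega>)) \<in> borel_measurable M"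
        by (subst measurable_cong[OF nn_integral_count_space_enumeration[OF e lf]])
    qed
    finally show ?thesis .
  qed
  have "lborel = \<nu>"
  proof (rule lborel_eqI)
    fix l u :: 'b
    assume lu: "\<And>b. b \<in> Basis \<Longrightarrow> l \<bullet> b \<le> u \<bullet> b"
    let ?a = "\<gamma> * measure lborel (box l u)"
    have pv: "poisson_variable M ?a (\<lambda>\<omega>. card (P \<omega> \<inter> box l u))"
      by (rule poisson_variable_card[OF P]) auto
    have "emeasure \<nu> (box l u) = (\<integral>\<^sup>+ x. indicator (box l u) x \<partial>\<nu>)"
      by (simp add: \<nu>_def)
    also have "\<dots> = (\<integral>\<^sup>+ \<omega>. (\<integral>\<^sup>+ x. indicator (box l u) x \<partial>count_space (P \<omega>)) \<partial>M) / ennreal \<gamma>"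
      by (rule \<nu>) auto
    also have "(\<integral>\<^sup>+ \<omega>. (\<integral>\<^sup>+ x. indicator (box l u) x \<partial>count_space (P \<omega>)) \<partial>M) =
        (\<integral>\<^sup>+ \<omega>. of_nat (card (P \<omega> \<inter> box l u)) \<partial>M)"
    proof (intro nn_integral_cong)
      fix \<omega> assume "\<omega> \<in> space M"
      then have "finite (P \<omega> \<inter> box l u)"
        using finite_Int_bounded[OF lf bounded_box] by auto
      then have "emeasure (count_space (P \<omega>)) (P \<omega> \<inter> box l u) = of_nat (card (P \<omega> \<inter> box l u))"
        by (simp add: emeasure_count_space_finite)
      moreover have "(\<integral>\<^sup>+ x. indicator (box l u) x \<partial>count_space (P \<omega>)) =
          (\<integral>\<^sup>+ x. indicator (P \<omega> \<inter> box l u) x \<partial>count_space (P \<omega>))"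
        by (intro nn_integral_cong) (auto simp: indicator_def)
      ultimately show "(\<integral>\<^sup>+ x. indicator (box l u) x \<partial>count_space (P \<omega>)) = of_nat (card (P \<omega> \<inter> box l u))"
        by simp
    qed
    also have "\<dots> = ennreal ?a"
      using \<gamma> by (intro nn_integral_poisson_variable_mean[OF pv]) auto
    also have "\<dots> / ennreal \<gamma> = ennreal (measure lborel (box l u))"
      using \<gamma> by (simp add: divide_ennreal)
    also have "\<dots> = emeasure lborel (box l u)"
      using emeasure_bounded_finite[OF bounded_box, of l u] by (simp add: emeasure_eq_ennreal_measure)
    also have "\<dots> = ennreal (\<Prod>b\<in>Basis. (u - l) \<bullet> b)"
      using lu by (simp add: emeasure_lborel_box)
    finally show "emeasure \<nu> (box l u) = ennreal (\<Prod>b\<in>Basis. (u - l) \<bullet> b)" .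
  qed (simp add: \<nu>_def)
  then have "ennreal \<gamma> * (\<integral>\<^sup>+ x. \<phi> x \<partial>lborel) =
      ennreal \<gamma> * ((\<integral>\<^sup>+ \<omega>. (\<integral>\<^sup>+ x. \<phi> x \<partial>count_space (P \<omega>)) \<partial>M) / ennreal \<gamma>)"
    using \<nu>[OF \<phi>] by simp
  also have "\<dots> = (\<integral>\<^sup>+ \<omega>. (\<integral>\<^sup>+ x. \<phi> x \<partial>count_space (P \<omega>)) \<partial>M)"
    unfolding ennreal_times_divide mult.commute[of "ennreal \<gamma>"]
    using \<gamma> by (intro mult_divide_eq_ennreal) auto
  finally show ?thesis by simp
qed

text \<open>
  Campbell's formula when the summand also depends on an independent random element \<open>U\<close>: by
  independence \<open>U\<close> can be integrated out first, for a fixed configuration of \<open>P\<close>.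
\<close>

lemma nn_integral_poisson_process_indep:
  fixes P :: "'a \<Rightarrow> 'b::euclidean_space set" and e :: "nat \<Rightarrow> 'b set \<Rightarrow> 'b"
  assumes P: "homogeneous_poisson_process M \<gamma> P" and \<gamma>: "0 < \<gamma>"
    and ind: "indep_var config_space P N U"
    and e: "point_enumeration e"
    and \<psi> [measurable]: "(\<lambda>(x, T). \<psi> x T) \<in> borel_measurable (borel \<Otimes>\<^sub>M N)"
  shows "(\<integral>\<^sup>+ \<omega>. (\<integral>\<^sup>+ x. \<psi> x (U \<omega>) \<partial>count_space (P \<omega>)) \<partial>M) =
    ennreal \<gamma> * (\<integral>\<^sup>+ x. (\<integral>\<^sup>+ \<omega>. \<psi> x (U \<omega>) \<partial>M) \<partial>lborel)"
proof -
  have Pm [measurable]: "P \<in> M \<rightarrow>\<^sub>M config_space" and Um [measurable]: "U \<in> M \<rightarrow>\<^sub>M N"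
    and joint: "distr M config_space P \<Otimes>\<^sub>M distr M N U = distr M (config_space \<Otimes>\<^sub>M N) (\<lambda>\<omega>. (P \<omega>, U \<omega>))"
    using ind by (auto simp: indep_var_distribution_eq)
  have lf: "locally_finite (P \<omega>)" if "\<omega> \<in> space M" for \<omega>
    using measurable_space[OF Pm that] by (simp add: space_config_space)
  interpret N: prob_space "distr M N U"
    by (rule prob_space_distr) measurable
  have [measurable]: "e i \<in> config_space \<rightarrow>\<^sub>M borel" for i
    using e by (auto simp: point_enumeration_def)
  have [measurable]: "(\<lambda>z. \<psi> (e i (fst z)) (snd z)) \<in> borel_measurable (config_space \<Otimes>\<^sub>M N)" for i
    using measurable_compose[OF _ \<psi>, of "\<lambda>z. (e i (fst z), snd z)" "config_space \<Otimes>\<^sub>M N"] by simp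
  have K: "(\<lambda>z. \<Sum>i. indicator (indices (fst z)) i * \<psi> (e i (fst z)) (snd z)) \<in> borel_measurable (config_space \<Otimes>\<^sub>M N)"
    unfolding indicator_def by measurable
  have \<psi>': "(\<lambda>x. \<integral>\<^sup>+ T. \<psi> x T \<partial>distr M N U) \<in> borel_measurable borel"
    using N.borel_measurable_nn_integral_fst[of "\<lambda>(x, T). \<psi> x T" borel] by simp
  have \<psi>_sec: "\<psi> x \<in> borel_measurable N" for x
    using measurable_compose[OF measurable_Pair1' \<psi>, of x] by simp
  have "(\<integral>\<^sup>+ \<omega>. (\<integral>\<^sup>+ x. \<psi> x (U \<omega>) \<partial>count_space (P \<omega>)) \<partial>M) =
      (\<integral>\<^sup>+ \<omega>. (\<Sum>i. indicator (indices (P \<omega>)) i * \<psi> (e i (P \<omega>)) (U \<omega>)) \<partial>M)"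
    by (intro nn_integral_cong nn_integral_count_space_enumeration[OF e lf])
  also have "\<dots> = (\<integral>\<^sup>+ z. (\<Sum>i. indicator (indices (fst z)) i * \<psi> (e i (fst z)) (snd z))
      \<partial>(distr M config_space P \<Otimes>\<^sub>M distr M N U))"
    unfolding joint using K by (subst nn_integral_distr) auto
  also have "\<dots> = (\<integral>\<^sup>+ S. (\<integral>\<^sup>+ T. (\<Sum>i. indicator (indices S) i * \<psi> (e i S) T) \<partial>distr M N U)
      \<partial>distr M config_space P)"
    using K by (subst N.nn_integral_fst[symmetric])
      (simp_all add: measurable_cong_sets[OF sets_pair_measure_cong[OF sets_distr sets_distr] refl])
  also have "\<dots> = (\<integral>\<^sup>+ \<omega>. (\<integral>\<^sup>+ T. (\<Sum>i. indicator (indices (P \<omega>)) i * \<psi> (e i (P \<omega>)) T) \<partial>distr M N U) \<partial>M)"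
    using N.borel_measurable_nn_integral_fst[of _ config_space] K
    by (subst nn_integral_distr) (auto simp: measurable_cong_sets[OF sets_pair_measure_cong[OF refl sets_distr] refl])
  also have "\<dots> = (\<integral>\<^sup>+ \<omega>. (\<Sum>i. indicator (indices (P \<omega>)) i * (\<integral>\<^sup>+ T. \<psi> (e i (P \<omega>)) T \<partial>distr M N U)) \<partial>M)"
    using \<psi>_sec by (simp add: nn_integral_suminf nn_integral_cmult)
  also have "\<dots> = (\<integral>\<^sup>+ \<omega>. (\<integral>\<^sup>+ x. (\<integral>\<^sup>+ T. \<psi> x T \<partial>distr M N U) \<partial>count_space (P \<omega>)) \<partial>M)"
    by (intro nn_integral_cong nn_integral_count_space_enumeration[OF e lf, symmetric])
  also have "\<dots> = ennreal \<gamma> * (\<integral>\<^sup>+ x. (\<integral>\<^sup>+ T. \<psi> x T \<partial>distr M N U) \<partial>lborel)"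
    by (rule nn_integral_poisson_process[OF P \<gamma> e \<psi>'])
  finally show ?thesis
    using \<psi>_sec by (simp add: nn_integral_distr)
qed

text \<open>
  Inclusion and exclusion. Conditional probabilities are given for intersections of events, i.e. for
  products of their indicators; this transfers them to intersections of the complements.
\<close>

lemma expectation_prod_one_minus:
  fixes b r :: "'i \<Rightarrow> 'a \<Rightarrow> real"
  assumes T: "finite T"
    and b: "\<And>X. X \<subseteq> T \<Longrightarrow> integrable M (\<lambda>\<omega>. w \<omega> * (\<Prod>j\<in>X. b j \<omega>))"
    and r: "\<And>X. X \<subseteq> T \<Longrightarrow> integrable M (\<lambda>\<omega>. w \<omega> * (\<Prod>j\<in>X. r j \<omega>))"
    and eq: "\<And>X. X \<subseteq> T \<Longrightarrow>
      expectation (\<lambda>\<omega>. w \<omega> * (\<Prod>j\<in>X. b j \<omega>)) = expectation (\<lambda>\<omega>. w \<omega> * (\<Prod>j\<in>X. r j \<omega>))"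
  shows "expectation (\<lambda>\<omega>. w \<omega> * (\<Prod>j\<in>T. 1 - b j \<omega>)) =
    expectation (\<lambda>\<omega>. w \<omega> * (\<Prod>j\<in>T. 1 - r j \<omega>))"
proof -
  have expand: "w \<omega> * (\<Prod>j\<in>T. 1 - c j \<omega>) =
      (\<Sum>X\<in>Pow T. (-1) ^ card X * (w \<omega> * (\<Prod>j\<in>X. c j \<omega>)))" for c :: "'i \<Rightarrow> 'a \<Rightarrow> real" and \<omega>
    by (simp add: prod_diff_conv_sum[OF T] sum_distrib_left mult_ac)
  show ?thesis
    unfolding expand using b r eq
    by (simp add: Bochner_Integration.integral_sum)
qed

end


section \<open>The expected degree of the origin\<close>

text \<open>
  The conditional probability, given the points, that the \<open>i\<close>-th vertex and the \<open>j\<close>-th group are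
  connected.
\<close>

definition pair_prob ::
    "('a::euclidean_space \<Rightarrow> real) \<Rightarrow> (nat \<Rightarrow> 'a set \<Rightarrow> 'a) \<Rightarrow> 'a set \<Rightarrow> 'a set \<Rightarrow> nat \<times> nat \<Rightarrow> real" where
  "pair_prob g e S T = (\<lambda>(i, j). if i \<in> indices S \<and> j \<in> indices T then g (e i S - e j T) else 0)"

text \<open>
  The random intersection model with a choice of the enumeration whose existence is part of
  \<^const>\<open>random_connections\<close>. Radiality of \<open>g\<close> enters as reflection symmetry, which replaces
  \<open>g (0 - u)\<close> by \<open>g u\<close>.
\<close>

locale enumerated_model = random_intersection_model M lam mu g P V U E
  for M :: "'w measure" and lam mu and g :: "'a::euclidean_space \<Rightarrow> real" and P V U E +
  fixes e :: "nat \<Rightarrow> 'a set \<Rightarrow> 'a"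
  assumes enum: "point_enumeration e"
    and connected_sets [measurable]: "\<And>p. connected_event M e V U E p \<in> sets M"
    and connected_cond_prob: "\<And>F. finite F \<Longrightarrow> AE \<omega> in M.
      real_cond_exp M
        (vimage_algebra (space M) (\<lambda>\<omega>. (V \<omega>, U \<omega>)) (config_space \<Otimes>\<^sub>M config_space))
        (indicator {\<omega> \<in> space M. \<forall>p \<in> F. \<omega> \<in> connected_event M e V U E p}) \<omega> =
      (\<Prod>p\<in>F. pair_prob g e (V \<omega>) (U \<omega>) p)"
    and g_nonneg: "\<And>x. 0 \<le> g x"
    and g_le_1: "\<And>x. g x \<le> 1"
    and g_minus: "\<And>x. g (- x) = g x"
    and g_measurable [measurable]: "g \<in> borel_measurable borel"
begin

abbreviation point_algebra :: "'w measure" where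
  "point_algebra \<equiv> vimage_algebra (space M) (\<lambda>\<omega>. (V \<omega>, U \<omega>)) (config_space \<Otimes>\<^sub>M config_space)"

abbreviation connected :: "nat \<Rightarrow> nat \<Rightarrow> 'w set" where
  "connected i j \<equiv> connected_event M e V U E (i, j)"

text \<open>
  The probability that a group at \<open>u\<close> is connected to both the origin and a vertex at \<open>v\<close>: the factor
  for the origin is \<open>g (0 - u) = g u\<close>.
\<close>

definition common_group_prob :: "'a \<Rightarrow> 'a \<Rightarrow> real" where
  "common_group_prob v u = g u * g (v - u)"

lemma common_group_prob_bounds: "0 \<le> common_group_prob v u" "common_group_prob v u \<le> 1"
  using g_nonneg g_le_1 by (auto simp: common_group_prob_def intro: mult_le_one)

lemma measurable_survival_common_group_prob [measurable (raw)]: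
  assumes [measurable]: "X \<in> borel_measurable N" "Y \<in> N \<rightarrow>\<^sub>M config_space"
  shows "(\<lambda>\<omega>. survival (common_group_prob (X \<omega>)) (Y \<omega>)) \<in> borel_measurable N"
proof -
  have "(\<lambda>(v, S). survival (common_group_prob v) S) \<in> borel_measurable (borel \<Otimes>\<^sub>M config_space)"
    using enum common_group_prob_bounds
    by (rule measurable_survival) (simp add: common_group_prob_def)
  from measurable_compose[OF _ this, of "\<lambda>\<omega>. (X \<omega>, Y \<omega>)" N]
  show ?thesis by simp
qed

lemma U_measurable: "U \<in> M \<rightarrow>\<^sub>M config_space"
  using poisson_U by (simp add: homogeneous_poisson_process_def)

declare V_measurable [measurable] U_measurable [measurable]

lemma e_measurable [measurable]: "e i \<in> config_space \<rightarrow>\<^sub>M borel"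
  using enum by (auto simp: point_enumeration_def)

lemma locally_finite_V: "\<omega> \<in> space M \<Longrightarrow> locally_finite (V \<omega>)"
  and locally_finite_U: "\<omega> \<in> space M \<Longrightarrow> locally_finite (U \<omega>)"
  using measurable_space[OF V_measurable] measurable_space[OF U_measurable]
  by (auto simp: space_config_space)

lemma pair_prob_bounds: "0 \<le> pair_prob g e S T p" "pair_prob g e S T p \<le> 1"
  using g_nonneg g_le_1 by (auto simp: pair_prob_def split: prod.split)

lemma pair_prob_measurable [measurable]:
  "(\<lambda>\<omega>. pair_prob g e (V \<omega>) (U \<omega>) p) \<in> borel_measurable M"
proof (cases p)
  case (Pair i j)
  then show ?thesis unfolding pair_prob_def by simp
qed

lemma subalgebra_point_algebra: "subalgebra M point_algebra"
proof -
  have "(\<lambda>\<omega>. (V \<omega>, U \<omega>)) \<in> M \<rightarrow>\<^sub>M config_space \<Otimes>\<^sub>M config_space"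
    by measurable
  then show ?thesis
    by (simp add: subalgebra_def sets_image_in_sets)
qed

text \<open>
  The averaged form of the conditional probability: an event \<open>G\<close> that depends on the points only can be
  fixed, for instance one that tells which index belongs to the origin.
\<close>

lemma expectation_connected:
  assumes G: "G \<in> sets point_algebra" and F: "finite F"
  shows "expectation (\<lambda>\<omega>. indicator G \<omega> * (\<Prod>p\<in>F. indicat_real (connected_event M e V U E p) \<omega>)) =
    expectation (\<lambda>\<omega>. indicator G \<omega> * (\<Prod>p\<in>F. pair_prob g e (V \<omega>) (U \<omega>) p))"
proof -
  interpret A: finite_measure_subalgebra M point_algebra
    by unfold_locales (rule subalgebra_point_algebra)
  let ?A = "{\<omega> \<in> space M. \<forall>p\<in>F. \<omega> \<in> connected_event M e V U E p}"
  have [measurable]: "G \<in> sets M"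
    using G subalgebra_point_algebra by (auto simp: subalgebra_def)
  have [measurable]: "?A \<in> sets M"
    using F by measurable
  have "(\<Prod>p\<in>F. indicat_real (connected_event M e V U E p) \<omega>) = (indicator ?A \<omega> :: real)"
    if "\<omega> \<in> space M" for \<omega>
    using F that by (induction F rule: finite_induct) (auto simp: indicator_def)
  then have "expectation (\<lambda>\<omega>. indicator G \<omega> * (\<Prod>p\<in>F. indicat_real (connected_event M e V U E p) \<omega>)) =
      (\<integral>\<omega>\<in>G. indicator ?A \<omega> \<partial>M)"
    unfolding set_lebesgue_integral_def by (intro Bochner_Integration.integral_cong) auto
  also have "\<dots> = (\<integral>\<omega>\<in>G. real_cond_exp M point_algebra (indicator ?A) \<omega> \<partial>M)"
    using G by (intro A.real_cond_exp_intA integrable_const_bound[where B = 1]) (auto simp: indicator_def)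
  also have "\<dots> = expectation (\<lambda>\<omega>. indicator G \<omega> * (\<Prod>p\<in>F. pair_prob g e (V \<omega>) (U \<omega>) p))"
    unfolding set_lebesgue_integral_def
    using connected_cond_prob[OF F]
    by (intro integral_cong_AE) (auto intro: borel_measurable_times)
  finally show ?thesis .
qed

text \<open>
  Given the points, the events that the \<open>j\<close>-th group is connected to both the \<open>k\<close>-th vertex (the origin)
  and the \<open>i\<close>-th vertex are independent for different \<open>j\<close>, because they involve disjoint sets of pairs. Hence
  no group is common to both vertices with conditional probability equal to the infinite product
  \<^const>\<open>survival\<close>. For finitely many groups this is inclusion and exclusion, and then the number of groups
  tends to infinity.
\<close>

lemma emeasure_common_group:
  assumes G: "G \<in> sets point_algebra" and ik: "i \<noteq> k"
    and Gik: "\<And>\<omega>. \<omega> \<in> G \<Longrightarrow> i \<in> indices (V \<omega>) \<and> k \<in> indices (V \<omega>) \<and> e k (V \<omega>) = 0"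
  shows "emeasure M (G \<inter> (\<Union>j. connected k j \<inter> connected i j)) =
    (\<integral>\<^sup>+ \<omega>. indicator G \<omega> * ennreal (1 - survival (common_group_prob (e i (V \<omega>))) (U \<omega>)) \<partial>M)"
proof -
  have Gm [measurable]: "G \<in> sets M"
    using G subalgebra_point_algebra by (auto simp: subalgebra_def)
  have G_space: "\<omega> \<in> space M" if "\<omega> \<in> G" for \<omega>
    using sets.sets_into_space[OF Gm] that by auto
  define B where "B j = connected k j \<inter> connected i j" for j
  have [measurable]: "B j \<in> sets M" for j
    unfolding B_def by measurable
  define b :: "nat \<Rightarrow> 'w \<Rightarrow> real" where "b j = indicator (B j)" for j
  define r where "r j \<omega> = pair_prob g e (V \<omega>) (U \<omega>) (k, j) * pair_prob g e (V \<omega>) (U \<omega>) (i, j)" for j \<omega>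
  have [measurable]: "b j \<in> borel_measurable M" "r j \<in> borel_measurable M" for j
    unfolding b_def r_def by measurable
  have b01: "0 \<le> b j \<omega>" "b j \<omega> \<le> 1" and r01: "0 \<le> r j \<omega>" "r j \<omega> \<le> 1" for j \<omega>
    using pair_prob_bounds by (auto simp: b_def r_def indicator_def intro: mult_le_one)
  have int: "integrable M (\<lambda>\<omega>. indicator G \<omega> * (\<Prod>j\<in>X. c j \<omega>))"
    if [measurable]: "\<And>j. c j \<in> borel_measurable M" and c: "\<And>j \<omega>. 0 \<le> c j \<omega>" "\<And>j \<omega>. c j \<omega> \<le> 1"
    for c :: "nat \<Rightarrow> 'w \<Rightarrow> real" and X
  proof (rule integrable_const_bound[where B = 1])
    have "0 \<le> (\<Prod>j\<in>X. c j \<omega>)" "(\<Prod>j\<in>X. c j \<omega>) \<le> 1" for \<omega>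
      using c by (auto intro: prod_nonneg prod_le_1)
    then show "AE \<omega> in M. norm (indicator G \<omega> * (\<Prod>j\<in>X. c j \<omega>)) \<le> 1"
      by (auto simp: indicator_def)
  qed measurable
  have fin: "expectation (\<lambda>\<omega>. indicator G \<omega> * (\<Prod>j<n. 1 - b j \<omega>)) =
      expectation (\<lambda>\<omega>. indicator G \<omega> * (\<Prod>j<n. 1 - r j \<omega>))" for n
  proof (rule expectation_prod_one_minus)
    fix X assume X: "X \<subseteq> {..<n}"
    then have "finite X" by (rule finite_subset) auto
    \<comment> \<open>As \<open>i \<noteq> k\<close>, the pairs are distinct and the product formula applies to \<open>{k, i} \<times> X\<close>.\<close>
    have split: "(\<Prod>j\<in>X. c (k, j) * c (i, j)) = (\<Prod>p\<in>{k, i} \<times> X. c p)" for c :: "nat \<times> nat \<Rightarrow> real"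
      using prod.cartesian_product[of "\<lambda>a j. c (a, j)" X "{k, i}"] ik
      by (simp add: prod.distrib)
    have "(\<Prod>j\<in>X. b j \<omega>) = (\<Prod>p\<in>{k, i} \<times> X. indicat_real (connected_event M e V U E p) \<omega>)" for \<omega>
      unfolding split[symmetric] by (simp add: b_def B_def indicator_inter_arith)
    moreover have "(\<Prod>j\<in>X. r j \<omega>) = (\<Prod>p\<in>{k, i} \<times> X. pair_prob g e (V \<omega>) (U \<omega>) p)" for \<omega>
      unfolding split[symmetric] by (simp add: r_def)
    ultimately show "expectation (\<lambda>\<omega>. indicator G \<omega> * (\<Prod>j\<in>X. b j \<omega>)) =
        expectation (\<lambda>\<omega>. indicator G \<omega> * (\<Prod>j\<in>X. r j \<omega>))"
      using expectation_connected[OF G, of "{k, i} \<times> X"] \<open>finite X\<close> by simp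
  qed (auto intro!: int b01 r01)
  have q: "\<omega> \<in> G \<Longrightarrow> r j \<omega> = (if j \<in> indices (U \<omega>) then common_group_prob (e i (V \<omega>)) (e j (U \<omega>)) else 0)" for j \<omega>
    using Gik by (auto simp: r_def pair_prob_def common_group_prob_def g_minus)
  define s where "s \<omega> = survival (common_group_prob (e i (V \<omega>))) (U \<omega>)" for \<omega>
  have s01: "0 \<le> s \<omega>" "s \<omega> \<le> 1" for \<omega>
    unfolding s_def by (auto intro!: survival_nonneg survival_le_1 common_group_prob_bounds)
  have [measurable]: "s \<in> borel_measurable M"
    unfolding s_def[abs_def] by measurable
  let ?c = "\<lambda>\<omega>. 1 - indicat_real (\<Union>j. B j) \<omega>"
  have bound: "norm (indicator G \<omega> * (\<Prod>j<n. 1 - c j \<omega>)) \<le> 1"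
    if "\<And>j \<omega>. 0 \<le> c j \<omega>" "\<And>j \<omega>. c j \<omega> \<le> 1" for c :: "nat \<Rightarrow> 'w \<Rightarrow> real" and \<omega> n
  proof -
    have "0 \<le> (\<Prod>j<n. 1 - c j \<omega>)" "(\<Prod>j<n. 1 - c j \<omega>) \<le> 1"
      using that by (auto intro!: prod_nonneg prod_le_1)
    then show ?thesis by (auto simp: indicator_def)
  qed
  have "(\<lambda>n. expectation (\<lambda>\<omega>. indicator G \<omega> * (\<Prod>j<n. 1 - b j \<omega>)))
      \<longlonglongrightarrow> expectation (\<lambda>\<omega>. indicator G \<omega> * ?c \<omega>)"
  proof (rule integral_dominated_convergence[where w = "\<lambda>_. 1"])
    have "(\<lambda>n. \<Prod>j<n. 1 - b j \<omega>) \<longlonglongrightarrow> ?c \<omega>" for \<omega>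
    proof (cases "\<omega> \<in> (\<Union>j. B j)")
      case True
      then obtain m where m: "\<omega> \<in> B m" by auto
      have "eventually (\<lambda>n. (\<Prod>j<n. 1 - b j \<omega>) = 0) sequentially"
        using eventually_gt_at_top[of m] by eventually_elim (use m in \<open>auto simp: b_def intro!: bexI[of _ m]\<close>)
      then show ?thesis
        using True by (auto intro: tendsto_eventually)
    qed (auto simp: b_def)
    then show "AE \<omega> in M. (\<lambda>n. indicator G \<omega> * (\<Prod>j<n. 1 - b j \<omega>)) \<longlonglongrightarrow> indicator G \<omega> * ?c \<omega>"
      by (intro AE_I2 tendsto_mult tendsto_const)
  qed (use bound[of b] b01 in auto)
  moreover have "(\<lambda>n. expectation (\<lambda>\<omega>. indicator G \<omega> * (\<Prod>j<n. 1 - r j \<omega>)))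
      \<longlonglongrightarrow> expectation (\<lambda>\<omega>. indicator G \<omega> * s \<omega>)"
  proof (rule integral_dominated_convergence[where w = "\<lambda>_. 1"])
    have "(\<lambda>n. indicator G \<omega> * (\<Prod>j<n. 1 - r j \<omega>)) \<longlonglongrightarrow> indicator G \<omega> * s \<omega>" for \<omega>
    proof (cases "\<omega> \<in> G")
      case True
      then show ?thesis
        using prod_enumeration_tendsto_survival[OF enum locally_finite_U[OF G_space[OF True]]
            common_group_prob_bounds[of "e i (V \<omega>)"]]
        by (simp add: q s_def)
    qed simp
    then show "AE \<omega> in M. (\<lambda>n. indicator G \<omega> * (\<Prod>j<n. 1 - r j \<omega>)) \<longlonglongrightarrow> indicator G \<omega> * s \<omega>"
      by simp
  qed (use bound[of r] r01 in auto)
  ultimately have lim: "expectation (\<lambda>\<omega>. indicator G \<omega> * ?c \<omega>) = expectation (\<lambda>\<omega>. indicator G \<omega> * s \<omega>)"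
    unfolding fin by (rule LIMSEQ_unique)
  have int_G: "integrable M (\<lambda>\<omega>. indicator G \<omega> :: real)"
    by (intro integrable_const_bound[where B = 1]) (auto simp: indicator_def)
  have int_c: "integrable M (\<lambda>\<omega>. indicator G \<omega> * ?c \<omega>)"
    by (intro integrable_const_bound[where B = 1]) (auto simp: indicator_def)
  have int_s: "integrable M (\<lambda>\<omega>. indicator G \<omega> * s \<omega>)"
    using s01 by (intro integrable_const_bound[where B = 1]) (auto simp: indicator_def)
  have "emeasure M (G \<inter> (\<Union>j. B j)) = ennreal (expectation (indicator (G \<inter> (\<Union>j. B j))))"
    by (simp add: emeasure_eq_measure)
  also have "expectation (indicator (G \<inter> (\<Union>j. B j))) =
      expectation (\<lambda>\<omega>. indicator G \<omega> - indicator G \<omega> * ?c \<omega>)"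
    by (intro Bochner_Integration.integral_cong) (auto simp: indicator_def)
  also have "\<dots> = expectation (\<lambda>\<omega>. indicator G \<omega> - indicator G \<omega> * s \<omega>)"
    using int_G int_c int_s lim by simp
  also have "ennreal \<dots> = (\<integral>\<^sup>+ \<omega>. ennreal (indicator G \<omega> - indicator G \<omega> * s \<omega>) \<partial>M)"
    using s01 int_G int_s
    by (intro nn_integral_eq_integral[symmetric]) (auto simp: indicator_def)
  also have "\<dots> = (\<integral>\<^sup>+ \<omega>. indicator G \<omega> * ennreal (1 - s \<omega>) \<partial>M)"
    by (intro nn_integral_cong) (auto simp: indicator_def)
  finally show ?thesis
    by (simp add: B_def s_def)
qed

text \<open>
  The origin always belongs to \<open>V\<close>, but its index depends on the configuration. Decomposing according to
  the value \<open>k\<close> of this index leaves only fixed pairs of indices, as in the product formula for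
  connections. For \<open>i = k\<close> the event is empty.
\<close>

definition origin_index_event :: "nat \<Rightarrow> nat \<Rightarrow> 'w set" where
  "origin_index_event k i = {\<omega> \<in> space M. k \<in> indices (V \<omega>) \<and> i \<in> indices (V \<omega>) \<and>
     e k (V \<omega>) = 0 \<and> e i (V \<omega>) \<noteq> 0}"

lemma origin_index_event_sets: "origin_index_event k i \<in> sets point_algebra"
proof -
  have "(\<lambda>\<omega>. (V \<omega>, U \<omega>)) \<in> point_algebra \<rightarrow>\<^sub>M config_space \<Otimes>\<^sub>M config_space"
    using measurable_space[OF V_measurable] measurable_space[OF U_measurable]
    by (intro measurable_vimage_algebra1) (auto simp: space_pair_measure)
  from measurable_compose[OF this measurable_fst]
  have [measurable]: "V \<in> point_algebra \<rightarrow>\<^sub>M config_space"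
    by simp
  have "{\<omega> \<in> space point_algebra. k \<in> indices (V \<omega>) \<and> i \<in> indices (V \<omega>) \<and>
     e k (V \<omega>) = 0 \<and> e i (V \<omega>) \<noteq> 0} \<in> sets point_algebra"
    by measurable
  then show ?thesis
    by (simp add: origin_index_event_def)
qed

lemma origin_index_event_sets_M [measurable]: "origin_index_event k i \<in> sets M"
  using origin_index_event_sets[of k i] subalgebra_point_algebra by (auto simp: subalgebra_def)

text \<open>
  Summation over \<open>k\<close> removes the decomposition again: in each configuration exactly one index is that of
  the origin.
\<close>

lemma suminf_origin_index:
  assumes \<omega>: "\<omega> \<in> space M" and k: "k \<in> indices (V \<omega>)" "e k (V \<omega>) = 0"
  shows "(\<Sum>k'. indicator (origin_index_event k' i \<inter> A k') \<omega> :: ennreal) =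
    indicator (indices (V \<omega>)) i * indicator {\<omega>. e i (V \<omega>) \<noteq> 0 \<and> \<omega> \<in> A k} \<omega>"
proof -
  have inj: "inj_on (\<lambda>i. e i (V \<omega>)) (indices (V \<omega>))"
    using enum locally_finite_V[OF \<omega>] by (auto simp: point_enumeration_def bij_betw_def)
  have "\<omega> \<notin> origin_index_event k' i" if "k' \<noteq> k" for k'
    using inj_onD[OF inj, of k' k] k that by (auto simp: origin_index_event_def)
  then have "(\<Sum>k'. indicator (origin_index_event k' i \<inter> A k') \<omega> :: ennreal) =
      (\<Sum>k'\<in>{k}. indicator (origin_index_event k' i \<inter> A k') \<omega>)"
    by (intro suminf_finite) (auto simp: indicator_def)
  also have "\<dots> = indicator (indices (V \<omega>)) i * indicator {\<omega>. e i (V \<omega>) \<noteq> 0 \<and> \<omega> \<in> A k} \<omega>"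
    using \<omega> k by (auto simp: indicator_def origin_index_event_def)
  finally show ?thesis .
qed

lemma origin_index_ex:
  assumes "\<omega> \<in> space M"
  obtains k where "k \<in> indices (V \<omega>)" "e k (V \<omega>) = 0"
proof -
  have "bij_betw (\<lambda>i. e i (V \<omega>)) (indices (V \<omega>)) (V \<omega>)"
    using enum locally_finite_V[OF assms] by (auto simp: point_enumeration_def)
  then have "0 \<in> (\<lambda>i. e i (V \<omega>)) ` indices (V \<omega>)"
    by (auto simp: bij_betw_def V_eq)
  then show ?thesis using that by force
qed

lemma intersection_adj_iff_connected:
  assumes \<omega>: "\<omega> \<in> space M" and k: "k \<in> indices (V \<omega>)" "e k (V \<omega>) = 0"
    and i: "i \<in> indices (V \<omega>)"
  shows "intersection_adj (U \<omega>) (E \<omega>) 0 (e i (V \<omega>)) \<longleftrightarrow>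
    e i (V \<omega>) \<noteq> 0 \<and> \<omega> \<in> (\<Union>j. connected k j \<inter> connected i j)"
proof -
  have "bij_betw (\<lambda>j. e j (U \<omega>)) (indices (U \<omega>)) (U \<omega>)"
    using enum locally_finite_U[OF \<omega>] by (auto simp: point_enumeration_def)
  then have U: "U \<omega> = (\<lambda>j. e j (U \<omega>)) ` indices (U \<omega>)"
    by (simp add: bij_betw_def)
  have "(\<exists>u\<in>U \<omega>. (0, u) \<in> E \<omega> \<and> (e i (V \<omega>), u) \<in> E \<omega>) \<longleftrightarrow>
      (\<exists>j\<in>indices (U \<omega>). (0, e j (U \<omega>)) \<in> E \<omega> \<and> (e i (V \<omega>), e j (U \<omega>)) \<in> E \<omega>)"
    by (subst U) simp
  then show ?thesis
    using assms by (auto simp: intersection_adj_def connected_event_def)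
qed

text \<open>
  The degree is a double sum, over the index \<open>k\<close> of the origin and the index \<open>i\<close> of a neighbour, of
  indicators of events treated in \<open>emeasure_common_group\<close>; after taking expectations the same double sum
  is read backwards. The integrand vanishes at the origin, so \<open>V\<close> may be replaced by the Poisson
  process \<open>P\<close>.
\<close>

lemma nn_integral_degree:
  "(\<integral>\<^sup>+ \<omega>. intersection_degree (V \<omega>) (U \<omega>) (E \<omega>) 0 \<partial>M) =
    (\<integral>\<^sup>+ \<omega>. (\<integral>\<^sup>+ x. indicator (- {0}) x * ennreal (1 - survival (common_group_prob x) (U \<omega>))
      \<partial>count_space (P \<omega>)) \<partial>M)"
proof -
  define H where "H i k = (\<Union>j. connected k j \<inter> connected i j)" for i k
  have [measurable]: "H i k \<in> sets M" for i k
    unfolding H_def by measurable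
  define h where "h x T = ennreal (1 - survival (common_group_prob x) T)" for x T
  have [measurable]: "(\<lambda>\<omega>. h (e i (V \<omega>)) (U \<omega>)) \<in> borel_measurable M" for i
    unfolding h_def by measurable
  have deg: "intersection_degree (V \<omega>) (U \<omega>) (E \<omega>) 0 =
      (\<Sum>i. \<Sum>k. indicator (origin_index_event k i \<inter> H i k) \<omega>)" if \<omega>: "\<omega> \<in> space M" for \<omega>
  proof -
    obtain k where k: "k \<in> indices (V \<omega>)" "e k (V \<omega>) = 0"
      using origin_index_ex[OF \<omega>] .
    have "intersection_degree (V \<omega>) (U \<omega>) (E \<omega>) 0 =
        (\<integral>\<^sup>+ x. indicator {w \<in> V \<omega>. intersection_adj (U \<omega>) (E \<omega>) 0 w} x \<partial>count_space UNIV)"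
      by (simp add: intersection_degree_def)
    also have "\<dots> = (\<integral>\<^sup>+ x. indicator {w. intersection_adj (U \<omega>) (E \<omega>) 0 w} x * indicator (V \<omega>) x
        \<partial>count_space UNIV)"
      by (intro nn_integral_cong) (auto simp: indicator_def)
    also have "\<dots> = (\<integral>\<^sup>+ x. indicator {w. intersection_adj (U \<omega>) (E \<omega>) 0 w} x \<partial>count_space (V \<omega>))"
      by (simp add: nn_integral_restrict_space[symmetric] restrict_count_space)
    also have "\<dots> = (\<Sum>i. indicator (indices (V \<omega>)) i *
        indicator {w. intersection_adj (U \<omega>) (E \<omega>) 0 w} (e i (V \<omega>)))"
      by (rule nn_integral_count_space_enumeration[OF enum locally_finite_V[OF \<omega>]])
    also have "\<dots> = (\<Sum>i. \<Sum>k. indicator (origin_index_event k i \<inter> H i k) \<omega>)"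
    proof (rule suminf_cong)
      fix i
      show "indicator (indices (V \<omega>)) i * indicator {w. intersection_adj (U \<omega>) (E \<omega>) 0 w} (e i (V \<omega>)) =
          (\<Sum>k. indicator (origin_index_event k i \<inter> H i k) \<omega> :: ennreal)"
        unfolding suminf_origin_index[OF \<omega> k, of i "H i"]
        using intersection_adj_iff_connected[OF \<omega> k, of i]
        by (auto simp: indicator_def H_def)
    qed
    finally show ?thesis .
  qed
  have prob: "emeasure M (origin_index_event k i \<inter> H i k) =
      (\<integral>\<^sup>+ \<omega>. indicator (origin_index_event k i) \<omega> * h (e i (V \<omega>)) (U \<omega>) \<partial>M)" for i k
  proof (cases "i = k")
    case True
    then have "origin_index_event k i = {}"
      by (auto simp: origin_index_event_def)
    then show ?thesis by simp
  next
    case False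
    show ?thesis
      unfolding H_def h_def
      by (rule emeasure_common_group[OF origin_index_event_sets False])
        (simp add: origin_index_event_def)
  qed
  have sum: "(\<Sum>i. \<Sum>k. indicator (origin_index_event k i) \<omega> * h (e i (V \<omega>)) (U \<omega>)) =
      (\<integral>\<^sup>+ x. indicator (- {0}) x * h x (U \<omega>) \<partial>count_space (P \<omega>))" if \<omega>: "\<omega> \<in> space M" for \<omega>
  proof -
    obtain k where k: "k \<in> indices (V \<omega>)" "e k (V \<omega>) = 0"
      using origin_index_ex[OF \<omega>] .
    have "(\<Sum>i. \<Sum>k. indicator (origin_index_event k i) \<omega> * h (e i (V \<omega>)) (U \<omega>)) =
        (\<Sum>i. indicator (indices (V \<omega>)) i * (indicator (- {0}) (e i (V \<omega>)) * h (e i (V \<omega>)) (U \<omega>)))"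
      using suminf_origin_index[OF \<omega> k, of _ "\<lambda>_. UNIV"]
      by (intro suminf_cong) (auto simp: indicator_def)
    also have "\<dots> = (\<integral>\<^sup>+ x. indicator (- {0}) x * h x (U \<omega>) \<partial>count_space (V \<omega>))"
      by (rule nn_integral_count_space_enumeration[OF enum locally_finite_V[OF \<omega>], symmetric])
    also have "\<dots> = (\<integral>\<^sup>+ x. indicator (- {0}) x * h x (U \<omega>) * indicator (V \<omega>) x \<partial>count_space UNIV)"
      by (simp add: nn_integral_restrict_space[symmetric] restrict_count_space)
    also have "\<dots> = (\<integral>\<^sup>+ x. indicator (- {0}) x * h x (U \<omega>) * indicator (P \<omega>) x \<partial>count_space UNIV)"
      by (intro nn_integral_cong) (auto simp: indicator_def V_eq)
    also have "\<dots> = (\<integral>\<^sup>+ x. indicator (- {0}) x * h x (U \<omega>) \<partial>count_space (P \<omega>))"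
      by (simp add: nn_integral_restrict_space[symmetric] restrict_count_space)
    finally show ?thesis .
  qed
  have "(\<integral>\<^sup>+ \<omega>. intersection_degree (V \<omega>) (U \<omega>) (E \<omega>) 0 \<partial>M) =
      (\<integral>\<^sup>+ \<omega>. (\<Sum>i. \<Sum>k. indicator (origin_index_event k i \<inter> H i k) \<omega>) \<partial>M)"
    by (intro nn_integral_cong deg)
  also have "\<dots> = (\<Sum>i. \<Sum>k. emeasure M (origin_index_event k i \<inter> H i k))"
    by (simp add: nn_integral_suminf)
  also have "\<dots> = (\<integral>\<^sup>+ \<omega>. (\<Sum>i. \<Sum>k. indicator (origin_index_event k i) \<omega> * h (e i (V \<omega>)) (U \<omega>)) \<partial>M)"
    by (simp add: nn_integral_suminf prob del: ennreal_suminf_multc)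
  also have "\<dots> = (\<integral>\<^sup>+ \<omega>. (\<integral>\<^sup>+ x. indicator (- {0}) x * h x (U \<omega>) \<partial>count_space (P \<omega>)) \<partial>M)"
    by (intro nn_integral_cong sum)
  finally show ?thesis
    by (simp add: h_def)
qed

text \<open>
  The origin is a Lebesgue null set, so that excluding it from the neighbours does not change the integral.
\<close>

lemma expected_degree:
  assumes lam: "0 < lam" and mu: "0 \<le> mu" and g: "integrable lborel g"
  shows "(\<integral>\<^sup>+ \<omega>. intersection_degree (V \<omega>) (U \<omega>) (E \<omega>) 0 \<partial>M) =
    ennreal lam * (\<integral>\<^sup>+ y. ennreal (1 - exp (- (mu * (LINT x|lborel. g x * g (y - x))))) \<partial>lborel)"
proof -
  have "(\<lambda>(x, T). indicator (- {0}) x * ennreal (1 - survival (common_group_prob x) T))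
      \<in> borel_measurable (borel \<Otimes>\<^sub>M config_space)"
    by measurable
  note nn_integral_poisson_process_indep[OF poisson_P lam indep_P_U enum this]
  note campbell = trans[OF nn_integral_degree this]
  have surv: "(\<integral>\<^sup>+ \<omega>. ennreal (1 - survival (common_group_prob x) (U \<omega>)) \<partial>M) =
      ennreal (1 - exp (- (mu * (LINT u|lborel. g u * g (x - u)))))" for x
  proof -
    have int: "integrable lborel (common_group_prob x)"
    proof (rule Bochner_Integration.integrable_bound[OF g])
      show "AE u in lborel. norm (common_group_prob x u) \<le> norm (g u)"
        using g_nonneg g_le_1 by (auto simp: common_group_prob_def intro: mult_left_le)
    qed (simp add: common_group_prob_def[abs_def])
    have s01: "0 \<le> survival (common_group_prob x) (U \<omega>)" "survival (common_group_prob x) (U \<omega>) \<le> 1" for \<omega>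
      by (auto intro!: survival_nonneg survival_le_1 common_group_prob_bounds)
    have [measurable]: "(\<lambda>\<omega>. survival (common_group_prob x) (U \<omega>)) \<in> borel_measurable M"
      by measurable
    have ints: "integrable M (\<lambda>\<omega>. survival (common_group_prob x) (U \<omega>))"
      using s01 by (intro integrable_const_bound[where B = 1]) auto
    then have "(\<integral>\<^sup>+ \<omega>. ennreal (1 - survival (common_group_prob x) (U \<omega>)) \<partial>M) =
        ennreal (1 - expectation (\<lambda>\<omega>. survival (common_group_prob x) (U \<omega>)))"
      using s01 by (subst nn_integral_eq_integral) (auto simp: prob_space)
    then show ?thesis
      using expectation_survival[OF poisson_U mu common_group_prob_bounds int]
      by (simp add: common_group_prob_def)
  qed
  have "AE x :: 'a in lborel. x \<noteq> 0"
    by (rule AE_lborel_singleton)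
  then have "(\<integral>\<^sup>+ x. (\<integral>\<^sup>+ \<omega>. indicator (- {0}) x * ennreal (1 - survival (common_group_prob x) (U \<omega>)) \<partial>M)
      \<partial>lborel) = (\<integral>\<^sup>+ y. ennreal (1 - exp (- (mu * (LINT x|lborel. g x * g (y - x))))) \<partial>lborel)"
    by (intro nn_integral_cong_AE) (auto simp: surv)
  with campbell show ?thesis by simp
qed

end

theorem proposition3:
  fixes M :: "'w measure"
    and lam mu :: real
    and g f :: "'a::euclidean_space \<Rightarrow> real"
    and P V U :: "'w \<Rightarrow> 'a set"
    and E :: "'w \<Rightarrow> ('a \<times> 'a) set"
    and D :: "'w \<Rightarrow> ennreal"
  assumes "lam > 0" and "mu > 0"
    and "\<And>x. 0 \<le> g x \<and> g x \<le> 1"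
    and "nonincreasing_radial g"
    and "integrable lborel g" and "0 < (LINT x|lborel. g x)"
    and "random_intersection_model M lam mu g P V U E"
    and "D = (\<lambda>\<omega>. intersection_degree (V \<omega>) (U \<omega>) (E \<omega>) 0)"
    and "f = (\<lambda>y. LINT x|lborel. g x * g (y - x))"
  shows "(\<integral>\<^sup>+ \<omega>. D \<omega> \<partial>M) =
    ennreal lam * (\<integral>\<^sup>+ y. ennreal (1 - exp (- (mu * f y))) \<partial>lborel)"
proof -
  interpret random_intersection_model M lam mu g P V U E
    by fact
  obtain e where e: "point_enumeration e" "\<And>p. connected_event M e V U E p \<in> sets M"
    and cond: "\<And>F. finite F \<Longrightarrow> AE \<omega> in M.
      real_cond_exp M
        (vimage_algebra (space M) (\<lambda>\<omega>. (V \<omega>, U \<omega>)) (config_space \<Otimes>\<^sub>M config_space))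
        (indicator {\<omega> \<in> space M. \<forall>p \<in> F. \<omega> \<in> connected_event M e V U E p}) \<omega> =
      (\<Prod>p\<in>F. pair_prob g e (V \<omega>) (U \<omega>) p)"
    using connections unfolding random_connections_def pair_prob_def by blast
  have "g (- x) = g x" for x
    using assms(4) unfolding nonincreasing_radial_def by (metis norm_minus_cancel)
  then interpret enumerated_model M lam mu g P V U E e
    using e cond assms(3,5) by unfold_locales auto
  show ?thesis
    unfolding assms(8,9) using assms(1,2,5) by (intro expected_degree) auto
qed

end
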